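(* Let $(Z,\mathfrak{Z})$ be a measurable space equipped with a $\sigma$-finite measure $\nu$, and let $\Pi$ be the law of the Poisson point process with intensity $\nu$ on $\mathcal{M}$. Let $\mathcal{E}(F,G)=(\Pi\otimes\nu)(DF\,DG)$ be the associated Dirichlet form with domain $\mathrm{Dom}\,\mathcal{E}=\mathrm{Dom}\,D$, and let $\mathrm{Dom}\,\Gamma\subset \mathrm{Dom}\,\mathcal{E}$ be the set of those $F$ whose functional carré du champ $\mathbf{\Gamma}(F)$ is represented by a measure absolutely continuous with respect to $\Pi$, with density denoted $\Gamma(F)$. Then $\mathrm{Dom}\,\Gamma=\mathrm{Dom}\,D$ and, for all $F\in \mathrm{Dom}\,D$, $$\Gamma(F)(\eta)=\frac12\int_Z \big(D_z^{+}F(\eta)\big)^2\,\nu(\mathrm{d}z)+\frac12\int_Z \big(D_z^{-}F(\eta)\big)^2\,\eta(\mathrm{d}z)\qquad\text{for }\Pi\text{-almost every }\eta.$$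
   Context: No topological assumption is made on $(Z,\mathfrak{Z})$. $\mathcal{M}$ is the space of all countable sums of $\mathbb{N}$-valued measures on $(Z,\mathfrak{Z})$ (here $0\in\mathbb{N}$), endowed with the $\sigma$-algebra generated by the maps $\xi\mapsto\xi(B)\in\mathbb{N}\cup\{\infty\}$, $B\in\mathfrak{Z}$. The Poisson point process law $\Pi$ with intensity $\nu$ is the unique probability measure on $\mathcal{M}$ satisfying the Mecke equation $$\int\int u(\eta,z)\,\eta(\mathrm{d}z)\,\Pi(\mathrm{d}\eta)=\int\int u(\eta+\delta_z,z)\,\Pi(\mathrm{d}\eta)\,\nu(\mathrm{d}z)$$ for all measurable $u:\mathcal{M}\times Z\to[0,\infty]$. $\mathbf{E}_\Pi$ denotes integration with respect to $\Pi$. Add and drop operators: for measurable $F:\mathcal{M}\to\mathbb{R}$ and $z\in Z$, $D_z^{+}F(\eta)=F(\eta+\delta_z)-F(\eta)$ and $D_z^{-}F(\eta)=(F(\eta)-F(\eta-\delta_z))\,1_{z\in\eta}$, where $z\in\eta$ means that $\delta_z\le\eta$, so that $\eta-\delta_z$ is again a point measure. By the Mecke equation these do not depend on the representative of $F$ (up to null sets). Malliavin derivative: $\mathrm{Dom}\,D$ is the set of $F\in L^2(\Pi)$ with $\int_Z\int (D_z^{+}F(\eta))^2\,\Pi(\mathrm{d}\eta)\,\nu(\mathrm{d}z)<\infty$, and $DF$ is the map $z\mapsto D_z^{+}F$, an element of $L^2(\Pi\otimes\nu)$. For $F,G\in\mathrm{Dom}\,\mathcal{E}:=\mathrm{Dom}\,D$,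 $\mathcal{E}(F,G)=(\Pi\otimes\nu)(DF\,DG)=\int\int D_z^+F(\eta)\,D_z^+G(\eta)\,\Pi(\mathrm{d}\eta)\,\nu(\mathrm{d}z)$, and $\mathcal{E}(F)=\mathcal{E}(F,F)$; this is a Dirichlet form. Let $\mathcal{A}=\mathrm{Dom}\,D\cap L^\infty(\Pi)$, which is an algebra for pointwise multiplication. Functional carré du champ: for $F\in\mathcal{A}$, $\mathbf{\Gamma}(F)$ is the linear form on $\mathcal{A}$ given by $$\mathbf{\Gamma}(F)[\Phi]=\mathcal{E}(F,F\Phi)-\tfrac12\mathcal{E}(F^2,\Phi),\qquad \Phi\in\mathcal{A}.$$ It satisfies $0\le\mathbf{\Gamma}(F)[\Phi]\le\|\Phi\|_{L^\infty(\Pi)}\,\mathcal{E}(F)$ for all $F,\Phi\in\mathcal{A}$ with $\Phi\ge0$; this allows one to extend, for each $\Phi \in \mathcal{A}$, the map $F\mapsto\mathbf{\Gamma}(F)[\Phi]$ by continuity from $\mathcal{A}$ to all of $\mathrm{Dom}\,\mathcal{E}$ (equipped with the norm $(\mathbf{E}_\Pi F^2+\mathcal{E}(F))^{1/2}$). For $F\in\mathrm{Dom}\,\mathcal{E}$, one writes $F\in\mathrm{Dom}\,\Gamma$ if and only if there exists a non-negative $\Gamma(F)\in L^1(\Pi)$ such that $\mathbf{\Gamma}(F)[\Phi]=\mathbf{E}_\Pi[\Gamma(F)\,\Phi]$ for all $\Phi\in\mathcal{A}$.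
   Formalization: In the second integral, D⁻F is replaced by any jointly measurable function equal to D⁻F whenever δ_z ≤ η (such functions are shown to exist), since on general Z the literal D⁻F may be non-measurable and the formula can fail when η is not a sum of Dirac masses. *)

theory Defs
  imports "HOL-Probability.Probability" "HOL-Library.Going_To_Filter"
begin

text \<open>
  The measurable space underlying the point processes is \<open>(space \<nu>, sets \<nu>)\<close>, where \<open>\<nu>\<close> is the intensity measure.
\<close>

section \<open>Point measures\<close>

definition nat_valued_measure :: "'z measure \<Rightarrow> 'z measure \<Rightarrow> bool" where
  "nat_valued_measure \<nu> \<xi> \<longleftrightarrow>
     sets \<xi> = sets \<nu> \<and> (\<forall>B\<in>sets \<nu>. \<exists>k::nat. emeasure \<xi> B = of_nat k)"

text \<open>Finite sums are included, because the zero measure is \<open>\<nat>\<close>-valued.\<close>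

definition point_measures :: "'z measure \<Rightarrow> 'z measure set" where
  "point_measures \<nu> =
     {\<eta>. sets \<eta> = sets \<nu> \<and>
         (\<exists>\<xi> :: nat \<Rightarrow> 'z measure. (\<forall>n. nat_valued_measure \<nu> (\<xi> n)) \<and>
            (\<forall>B\<in>sets \<nu>. emeasure \<eta> B = (\<Sum>n. emeasure (\<xi> n) B)))}"

definition point_measure_space :: "'z measure \<Rightarrow> 'z measure measure" where
  "point_measure_space \<nu> =
     (SUP B\<in>sets \<nu>. vimage_algebra (point_measures \<nu>) (\<lambda>\<eta>. emeasure \<eta> B) borel)"

lemma space_point_measure_space: "space (point_measure_space \<nu>) = point_measures \<nu>"
  unfolding point_measure_space_def by (subst space_Sup_eq_UN) auto

lemma measurable_emeasure_point_measure_space: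
  assumes "B \<in> sets \<nu>"
  shows "(\<lambda>\<eta>. emeasure \<eta> B) \<in> borel_measurable (point_measure_space \<nu>)"
  unfolding point_measure_space_def
  using assms by (auto intro!: measurable_Sup1 measurable_vimage_algebra1)

definition sum_measure :: "'z measure \<Rightarrow> 'z measure \<Rightarrow> 'z measure" where
  "sum_measure M N = measure_of (space M) (sets M) (\<lambda>B. emeasure M B + emeasure N B)"

definition add_point :: "'z measure \<Rightarrow> 'z \<Rightarrow> 'z measure" where
  "add_point \<eta> z = sum_measure \<eta> (return \<eta> z)"

definition drop_point :: "'z measure \<Rightarrow> 'z \<Rightarrow> 'z measure" where
  "drop_point \<eta> z = diff_measure \<eta> (return \<eta> z)"

definition has_point :: "'z measure \<Rightarrow> 'z \<Rightarrow> bool" where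
  "has_point \<eta> z \<longleftrightarrow> return \<eta> z \<le> \<eta>"

text \<open>The law of the Poisson point process is characterised by the Mecke equation.\<close>

definition poisson_law :: "'z measure \<Rightarrow> 'z measure measure \<Rightarrow> bool" where
  "poisson_law \<nu> P \<longleftrightarrow>
     prob_space P \<and> sets P = sets (point_measure_space \<nu>) \<and>
     (\<forall>u :: 'z measure \<times> 'z \<Rightarrow> ennreal.
        u \<in> borel_measurable (point_measure_space \<nu> \<Otimes>\<^sub>M \<nu>) \<longrightarrow>
        (\<integral>\<^sup>+\<eta>. (\<integral>\<^sup>+z. u (\<eta>, z) \<partial>\<eta>) \<partial>P) =
        (\<integral>\<^sup>+z. (\<integral>\<^sup>+\<eta>. u (add_point \<eta> z, z) \<partial>P) \<partial>\<nu>))"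

section \<open>Add and drop operators\<close>

definition add_diff :: "('z measure \<Rightarrow> real) \<Rightarrow> 'z \<Rightarrow> 'z measure \<Rightarrow> real" where
  "add_diff F z \<eta> = F (add_point \<eta> z) - F \<eta>"

definition drop_diff :: "('z measure \<Rightarrow> real) \<Rightarrow> 'z \<Rightarrow> 'z measure \<Rightarrow> real" where
  "drop_diff F z \<eta> = (if has_point \<eta> z then F \<eta> - F (drop_point \<eta> z) else 0)"

text \<open>
  The set of pairs \<open>(\<eta>, z)\<close> with \<open>\<delta>\<^sub>z \<le> \<eta>\<close> need not be measurable, so neither need
  \<open>(\<eta>, z) \<mapsto> drop_diff F z \<eta>\<close> be, and its integral against \<open>\<eta>\<close> need not make sense.
  However, by the Mecke equation, a jointly measurable function that vanishes on this set of pairs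
  is null for the Campbell measure \<open>\<eta>(dz) P(d\<eta>)\<close>.  So all jointly measurable functions that
  take the values of the drop operator at these pairs agree Campbell-almost everywhere; they are
  the representatives of the drop operator.  (In a Borel space one may take \<open>drop_diff F\<close>
  itself, set to 0 for those \<open>\<eta>\<close> that are infinite on a set of some fixed countable
  exhaustion of finite intensity.)
\<close>

definition drop_diff_version ::
    "'z measure \<Rightarrow> 'z measure measure \<Rightarrow> ('z measure \<Rightarrow> real) \<Rightarrow> ('z measure \<times> 'z \<Rightarrow> real) \<Rightarrow> bool"
  where
  "drop_diff_version \<nu> P F w \<longleftrightarrow>
     w \<in> borel_measurable (P \<Otimes>\<^sub>M \<nu>) \<and>
     (AE \<eta> in P. \<forall>z\<in>space \<nu>. has_point \<eta> z \<longrightarrow> w (\<eta>, z) = drop_diff F z \<eta>)"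

lemma drop_diff_version_literal:
  assumes "w \<in> borel_measurable (P \<Otimes>\<^sub>M \<nu>)"
    and "AE \<eta> in P. \<forall>z\<in>space \<nu>. w (\<eta>, z) = drop_diff F z \<eta>"
  shows "drop_diff_version \<nu> P F w"
  using assms by (auto simp: drop_diff_version_def)

section \<open>Dirichlet form\<close>

text \<open>Elements of function spaces over \<open>P\<close> are measurable representatives, not a.e. classes.\<close>

definition Dom_D :: "'z measure \<Rightarrow> 'z measure measure \<Rightarrow> ('z measure \<Rightarrow> real) set" where
  "Dom_D \<nu> P =
     {F. F \<in> borel_measurable P \<and> integrable P (\<lambda>\<eta>. (F \<eta>)\<^sup>2) \<and>
         (\<integral>\<^sup>+z. (\<integral>\<^sup>+\<eta>. ennreal ((add_diff F z \<eta>)\<^sup>2) \<partial>P) \<partial>\<nu>) < \<infinity>}"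

definition dirichlet_form ::
    "'z measure \<Rightarrow> 'z measure measure \<Rightarrow> ('z measure \<Rightarrow> real) \<Rightarrow> ('z measure \<Rightarrow> real) \<Rightarrow> real" where
  "dirichlet_form \<nu> P F G = (\<integral>(\<eta>, z). add_diff F z \<eta> * add_diff G z \<eta> \<partial>(P \<Otimes>\<^sub>M \<nu>))"

definition dirichlet_norm :: "'z measure \<Rightarrow> 'z measure measure \<Rightarrow> ('z measure \<Rightarrow> real) \<Rightarrow> real" where
  "dirichlet_norm \<nu> P F = sqrt ((\<integral>\<eta>. (F \<eta>)\<^sup>2 \<partial>P) + dirichlet_form \<nu> P F F)"

definition bounded_Dom_D :: "'z measure \<Rightarrow> 'z measure measure \<Rightarrow> ('z measure \<Rightarrow> real) set" where
  "bounded_Dom_D \<nu> P = {F \<in> Dom_D \<nu> P. \<exists>c. AE \<eta> in P. \<bar>F \<eta>\<bar> \<le> c}"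

section \<open>Carre du champ\<close>

definition carre_form_bounded ::
    "'z measure \<Rightarrow> 'z measure measure \<Rightarrow> ('z measure \<Rightarrow> real) \<Rightarrow> ('z measure \<Rightarrow> real) \<Rightarrow> real" where
  "carre_form_bounded \<nu> P F \<Phi> =
     dirichlet_form \<nu> P F (\<lambda>\<eta>. F \<eta> * \<Phi> \<eta>) - 1 / 2 * dirichlet_form \<nu> P (\<lambda>\<eta>. (F \<eta>)\<^sup>2) \<Phi>"

text \<open>
  Extension by continuity: the limit of \<open>carre_form_bounded \<nu> P H \<Phi>\<close> as H tends to F in the
  Dirichlet norm, H ranging over \<open>bounded_Dom_D \<nu> P\<close> (with \<open>H = F\<close> allowed).
\<close>

definition carre_form ::
    "'z measure \<Rightarrow> 'z measure measure \<Rightarrow> ('z measure \<Rightarrow> real) \<Rightarrow> ('z measure \<Rightarrow> real) \<Rightarrow> real" where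
  "carre_form \<nu> P F \<Phi> =
     Lim ((\<lambda>H. dirichlet_norm \<nu> P (\<lambda>\<eta>. H \<eta> - F \<eta>)) going_to (nhds 0) within (bounded_Dom_D \<nu> P))
         (\<lambda>H. carre_form_bounded \<nu> P H \<Phi>)"

definition is_carre_du_champ ::
    "'z measure \<Rightarrow> 'z measure measure \<Rightarrow> ('z measure \<Rightarrow> real) \<Rightarrow> ('z measure \<Rightarrow> real) \<Rightarrow> bool" where
  "is_carre_du_champ \<nu> P F G \<longleftrightarrow>
     integrable P G \<and> (AE \<eta> in P. 0 \<le> G \<eta>) \<and>
     (\<forall>\<Phi>\<in>bounded_Dom_D \<nu> P. carre_form \<nu> P F \<Phi> = (\<integral>\<eta>. G \<eta> * \<Phi> \<eta> \<partial>P))"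

definition Dom_Gamma :: "'z measure \<Rightarrow> 'z measure measure \<Rightarrow> ('z measure \<Rightarrow> real) set" where
  "Dom_Gamma \<nu> P = {F \<in> Dom_D \<nu> P. \<exists>G. is_carre_du_champ \<nu> P F G}"

end

theory Submission
  imports Defs
begin

text \<open>
  The proof rests on an algebraic identity and the Mecke equation.  Write \<open>a, p\<close> for the values
  of \<open>F, \<Phi>\<close> at \<open>\<eta> + \<delta>\<^sub>z\<close>, and \<open>b, q\<close> for their values at \<open>\<eta>\<close>.  The integrand of
  \<open>\<E>(F, F \<Phi>) - \<E>(F\<^sup>2, \<Phi>) / 2\<close> is
  \<open>(a - b) (a p - b q) - (a\<^sup>2 - b\<^sup>2) (p - q) / 2 = (a - b)\<^sup>2 (p + q) / 2\<close>, so that for bounded \<open>F\<close>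
  the functional carre du champ is the weighted energy
  \<open>1/2 \<integral>\<integral> (D\<^sup>+\<^sub>z F(\<eta>))\<^sup>2 (\<Phi>(\<eta>) + \<Phi>(\<eta> + \<delta>\<^sub>z)) \<Pi>(d\<eta>) \<nu>(dz)\<close>.
  Since \<open>\<Phi>\<close> is bounded, this expression is continuous in the Dirichlet norm on the whole domain, and
  truncations of \<open>F\<close> are bounded and converge to \<open>F\<close>; so it is also the extension by continuity.

  The term with \<open>\<Phi>(\<eta>)\<close> is by Tonelli the integral of \<open>\<Phi>\<close> against half of
  \<open>\<integral> (D\<^sup>+\<^sub>z F)\<^sup>2 \<nu>(dz)\<close>.  For the term with \<open>\<Phi>(\<eta> + \<delta>\<^sub>z)\<close>, the value of \<open>D\<^sup>-\<^sub>z F\<close> at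
  \<open>\<eta> + \<delta>\<^sub>z\<close> is \<open>D\<^sup>+\<^sub>z F(\<eta>)\<close>, so the Mecke equation read from right to left turns it into the integral
  of \<open>\<Phi>\<close> against half of \<open>\<integral> (D\<^sup>-\<^sub>z F)\<^sup>2 \<eta>(dz)\<close>.  This gives a density
  (\<open>ex_measurable_gamma_integral\<close>, \<open>carre_form_eq\<close>, \<open>ex_carre_du_champ\<close>).

  The density is unique because the events whose indicators lie in the domain form a system
  that is stable under intersections and generates the \<open>\<sigma>\<close>-algebra: it contains every event that
  constrains only the number of points in a set of finite intensity
  (\<open>AE_eq_if_bounded_Dom_D_integrals_eq\<close>).

  On a general measurable space two questions of measurability remain.  The set of pairs \<open>(\<eta>, z)\<close> with
  \<open>\<delta>\<^sub>z \<le> \<eta>\<close> need not be measurable.  But subtraction of the point is measurable for the trace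
  \<open>\<sigma>\<close>-algebra on the part of this set where \<open>\<eta>\<close> is locally finite, and a real function that is
  measurable for a trace \<open>\<sigma>\<close>-algebra always extends; this yields versions of the drop operator
  (\<open>ex_drop_diff_version\<close>).  The map from \<open>\<eta>\<close> to an integral against \<open>\<eta>\<close> is shown to be measurable
  only outside a null set, on which \<open>\<eta>\<close> may charge a set of finite intensity infinitely often
  (\<open>AE_measurable_nn_integral_config\<close>).
\<close>

section \<open>Adding and removing a point\<close>

lemma sets_sum_measure [simp]: "sets (sum_measure M N) = sets M"
  and space_sum_measure [simp]: "space (sum_measure M N) = space M"
  by (auto simp: sum_measure_def)

lemma emeasure_sum_measure:
  assumes "sets N = sets M" "A \<in> sets M"
  shows "emeasure (sum_measure M N) A = emeasure M A + emeasure N A"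
  unfolding sum_measure_def
proof (rule emeasure_measure_of_sigma)
  show "sigma_algebra (space M) (sets M)" ..
  show "positive (sets M) (\<lambda>B. emeasure M B + emeasure N B)"
    by (simp add: positive_def)
  show "countably_additive (sets M) (\<lambda>B. emeasure M B + emeasure N B)"
    using assms(1) by (auto simp: countably_additive_def suminf_add[symmetric] suminf_emeasure)
qed fact

lemma sets_add_point [simp]: "sets (add_point \<eta> z) = sets \<eta>"
  and space_add_point [simp]: "space (add_point \<eta> z) = space \<eta>"
  by (auto simp: add_point_def)

lemma emeasure_add_point:
  assumes "B \<in> sets \<eta>"
  shows "emeasure (add_point \<eta> z) B = emeasure \<eta> B + indicator B z"
  using assms by (simp add: add_point_def emeasure_sum_measure)

lemma sets_drop_point [simp]: "sets (drop_point \<eta> z) = sets \<eta>"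
  and space_drop_point [simp]: "space (drop_point \<eta> z) = space \<eta>"
  by (auto simp: drop_point_def)

lemma has_point_iff:
  "has_point \<eta> z \<longleftrightarrow> (\<forall>B\<in>sets \<eta>. z \<in> B \<longrightarrow> 1 \<le> emeasure \<eta> B)"
  by (auto simp: has_point_def le_measure indicator_def)

text \<open>
  The subtracted mass is finite, so countable additivity of the difference may be checked after adding
  it back.
\<close>

lemma emeasure_drop_point:
  assumes "has_point \<eta> z" "B \<in> sets \<eta>"
  shows "emeasure (drop_point \<eta> z) B = emeasure \<eta> B - indicator B z"
proof -
  let ?\<mu> = "\<lambda>B. emeasure \<eta> B - (indicator B z :: ennreal)"
  have split: "?\<mu> A + indicator A z = emeasure \<eta> A" if "A \<in> sets \<eta>" for A
    using assms(1) that by (auto simp: has_point_iff indicator_def diff_add_cancel_ennreal)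
  have "emeasure (drop_point \<eta> z) B = emeasure \<eta> B - emeasure (return \<eta> z) B"
    unfolding drop_point_def diff_measure_def
  proof (rule emeasure_measure_of_sigma)
    show "sigma_algebra (space \<eta>) (sets \<eta>)" ..
    show "positive (sets \<eta>) (\<lambda>A. emeasure \<eta> A - emeasure (return \<eta> z) A)"
      by (simp add: positive_def)
    show "countably_additive (sets \<eta>) (\<lambda>A. emeasure \<eta> A - emeasure (return \<eta> z) A)"
    proof (rule countably_additiveI)
      fix A :: "nat \<Rightarrow> _"
      assume A: "range A \<subseteq> sets \<eta>" "disjoint_family A" "(\<Union>i. A i) \<in> sets \<eta>"
      then have A': "A i \<in> sets \<eta>" for i
        by auto
      have "(\<Sum>i. ?\<mu> (A i)) + indicator (\<Union>i. A i) z = (\<Sum>i. ?\<mu> (A i) + indicator (A i) z)"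
        using A(2) by (simp add: suminf_add[symmetric] suminf_indicator)
      also have "\<dots> = emeasure \<eta> (\<Union>i. A i)"
        using A by (simp add: split A' suminf_emeasure)
      finally have "(\<Sum>i. ?\<mu> (A i)) = ?\<mu> (\<Union>i. A i)"
        by (metis ennreal_add_diff_cancel_right ennreal_indicator ennreal_neq_top infinity_ennreal_def)
      with A' A(3) show "(\<Sum>i. emeasure \<eta> (A i) - emeasure (return \<eta> z) (A i)) =
          emeasure \<eta> (\<Union>i. A i) - emeasure (return \<eta> z) (\<Union>i. A i)"
        by simp
    qed
  qed fact
  with assms(2) show ?thesis
    by simp
qed

lemma has_point_add_point: "has_point (add_point \<eta> z) z"
  by (auto simp: has_point_iff emeasure_add_point)

lemma drop_point_add_point: "drop_point (add_point \<eta> z) z = \<eta>"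
proof (rule measure_eqI)
  fix B assume "B \<in> sets (drop_point (add_point \<eta> z) z)"
  then show "emeasure (drop_point (add_point \<eta> z) z) B = emeasure \<eta> B"
    by (auto simp: emeasure_drop_point has_point_add_point emeasure_add_point
        split: split_indicator)
qed simp

lemma drop_diff_add_point: "drop_diff F z (add_point \<eta> z) = add_diff F z \<eta>"
  by (simp add: drop_diff_def has_point_add_point drop_point_add_point add_diff_def)

lemma finite_suminf_of_nat_ennreal:
  assumes "(\<Sum>n. of_nat (k n) :: ennreal) \<noteq> \<infinity>"
  shows "\<exists>m::nat. (\<Sum>n. of_nat (k n) :: ennreal) = of_nat m"
proof -
  have "summable (\<lambda>n. real (k n))"
    using assms by (intro summable_suminf_not_top) (auto simp: ennreal_of_nat_eq_real_of_nat)
  then have "(\<lambda>n. real (k n)) \<longlonglongrightarrow> 0"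
    by (rule summable_LIMSEQ_zero)
  then have "eventually (\<lambda>n. real (k n) < 1) sequentially"
    by (rule order_tendstoD) simp
  then obtain N where N: "k n = 0" if "n \<ge> N" for n
    by (auto simp: eventually_sequentially)
  then have "(\<Sum>n. of_nat (k n) :: ennreal) = (\<Sum>n<N. of_nat (k n))"
    by (intro suminf_finite) auto
  then show ?thesis
    by (metis of_nat_sum)
qed

lemma sets_point_measure: "\<eta> \<in> point_measures \<nu> \<Longrightarrow> sets \<eta> = sets \<nu>"
  by (auto simp: point_measures_def)

lemma space_point_measure: "\<eta> \<in> point_measures \<nu> \<Longrightarrow> space \<eta> = space \<nu>"
  by (intro sets_eq_imp_space_eq sets_point_measure)

lemma point_measure_finite_eq_nat:
  assumes "\<eta> \<in> point_measures \<nu>" "B \<in> sets \<nu>" "emeasure \<eta> B \<noteq> \<infinity>"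
  shows "\<exists>m::nat. emeasure \<eta> B = of_nat m"
proof -
  obtain \<xi> :: "nat \<Rightarrow> _ measure" where \<xi>: "\<And>n. nat_valued_measure \<nu> (\<xi> n)"
    and sum: "emeasure \<eta> B = (\<Sum>n. emeasure (\<xi> n) B)"
    using assms by (auto simp: point_measures_def)
  have "\<exists>k. \<forall>n. emeasure (\<xi> n) B = of_nat (k n)"
    using \<xi> assms(2) by (intro choice) (auto simp: nat_valued_measure_def)
  then obtain k where "\<And>n. emeasure (\<xi> n) B = of_nat (k n)"
    by auto
  with sum finite_suminf_of_nat_ennreal[of k] assms(3) show ?thesis
    by simp
qed

lemma add_point_in_point_measures:
  assumes \<eta>: "\<eta> \<in> point_measures \<nu>"
  shows "add_point \<eta> z \<in> point_measures \<nu>"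
proof -
  obtain \<xi> :: "nat \<Rightarrow> _ measure" where \<xi>: "\<And>n. nat_valued_measure \<nu> (\<xi> n)"
    and sum: "\<And>B. B \<in> sets \<nu> \<Longrightarrow> emeasure \<eta> B = (\<Sum>n. emeasure (\<xi> n) B)"
    using \<eta> by (auto simp: point_measures_def)
  let ?\<xi> = "case_nat (return \<nu> z) \<xi>"
  have "nat_valued_measure \<nu> (?\<xi> n)" for n
    using \<xi> by (cases n) (auto simp: nat_valued_measure_def indicator_def
        intro: exI[of _ 0] exI[of _ "1::nat"])
  moreover have "emeasure (add_point \<eta> z) B = (\<Sum>n. emeasure (?\<xi> n) B)" if "B \<in> sets \<nu>" for B
    using that \<eta> suminf_offset[of "\<lambda>n. emeasure (?\<xi> n) B" 1]
    by (simp add: emeasure_add_point sets_point_measure sum add.commute)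
  ultimately show ?thesis
    using \<eta> by (auto simp: point_measures_def intro!: exI[of _ ?\<xi>])
qed

text \<open>
  Subtracting \<open>\<delta>\<^sub>z\<close> from a sum of \<open>\<nat>\<close>-valued measures need not be possible in one of the summands.
  When \<open>\<eta>\<close> is finite on the cells of a countable partition, the restrictions of \<open>\<eta> - \<delta>\<^sub>z\<close> to the cells
  are \<open>\<nat>\<close>-valued and serve as summands instead.
\<close>

lemma drop_point_in_point_measures:
  fixes D :: "nat \<Rightarrow> 'z set"
  assumes \<eta>: "\<eta> \<in> point_measures \<nu>" and z: "has_point \<eta> z"
    and D: "range D \<subseteq> sets \<nu>" "disjoint_family D" "(\<Union>n. D n) = space \<nu>"
    and fin: "\<And>n. emeasure \<eta> (D n) \<noteq> \<infinity>"
  shows "drop_point \<eta> z \<in> point_measures \<nu>"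
proof -
  let ?\<delta> = "drop_point \<eta> z"
  define \<xi> where "\<xi> n = density ?\<delta> (indicator (D n))" for n
  have sets: "sets \<eta> = sets \<nu>"
    using \<eta> by (rule sets_point_measure)
  have D': "D n \<in> sets \<nu>" for n
    using D(1) by auto
  have \<xi>: "emeasure (\<xi> n) B = emeasure ?\<delta> (D n \<inter> B)" if "B \<in> sets \<nu>" for n B
    using that D' by (simp add: \<xi>_def emeasure_restricted sets)
  have "\<exists>k::nat. emeasure (\<xi> n) B = of_nat k" if B: "B \<in> sets \<nu>" for n B
  proof -
    have "emeasure \<eta> (D n \<inter> B) \<le> emeasure \<eta> (D n)"
      using B D' sets by (intro emeasure_mono) auto
    then have "emeasure \<eta> (D n \<inter> B) \<noteq> \<infinity>"
      using fin[of n] by (auto simp: top_unique)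
    then obtain m :: nat where m: "emeasure \<eta> (D n \<inter> B) = of_nat m"
      using point_measure_finite_eq_nat[OF \<eta>] B D' by blast
    have "emeasure (\<xi> n) B = of_nat m - indicator (D n \<inter> B) z"
      using B D' m sets by (simp add: \<xi> emeasure_drop_point[OF z])
    also have "\<dots> = of_nat (m - indicator (D n \<inter> B) z)"
      by (cases m) (auto simp: indicator_def)
    finally show ?thesis ..
  qed
  then have "nat_valued_measure \<nu> (\<xi> n)" for n
    by (simp add: nat_valued_measure_def) (simp add: \<xi>_def sets)
  moreover have "emeasure ?\<delta> B = (\<Sum>n. emeasure (\<xi> n) B)" if "B \<in> sets \<nu>" for B
  proof -
    have "(\<Sum>n. emeasure ?\<delta> (D n \<inter> B)) = emeasure ?\<delta> (\<Union>n. D n \<inter> B)"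
      using that D sets by (intro suminf_emeasure) (auto simp: disjoint_family_on_def)
    also have "(\<Union>n. D n \<inter> B) = B"
      using that D(3) sets.sets_into_space by fastforce
    finally show ?thesis
      using that by (simp add: \<xi>)
  qed
  ultimately show ?thesis
    using sets by (auto simp: point_measures_def)
qed

lemma measurable_point_measure_spaceI:
  assumes "f \<in> space N \<rightarrow> point_measures \<nu>"
    and "\<And>B. B \<in> sets \<nu> \<Longrightarrow> (\<lambda>x. emeasure (f x) B) \<in> borel_measurable N"
  shows "f \<in> measurable N (point_measure_space \<nu>)"
  unfolding point_measure_space_def
  by (intro measurable_Sup2) (use assms in \<open>auto intro!: measurable_vimage_algebra2\<close>)

section \<open>Auxiliary facts of analysis\<close>

lemma ennreal_inverse_mult_le_1: "inverse a * a \<le> (1 :: ennreal)"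
proof (cases "a = 0 \<or> a = top")
  case False
  then show ?thesis
    using ennreal_divide_self[of a] by (simp add: divide_ennreal_def mult.commute less_top)
qed auto

text \<open>
  The set \<open>S\<close> need not be measurable.  Each level set of a simple function on \<open>S\<close> is the trace of a
  measurable set, so simple functions extend; a pointwise limit extends because taking the limit of
  a sequence, with a default value where it diverges, preserves measurability.
\<close>

lemma borel_measurable_restrict_space_extend:
  fixes f :: "'a \<Rightarrow> real"
  assumes f: "f \<in> borel_measurable (restrict_space M S)"
  obtains g where "g \<in> borel_measurable M" "\<And>x. x \<in> space M \<Longrightarrow> x \<in> S \<Longrightarrow> g x = f x"
proof -
  let ?R = "restrict_space M S"
  obtain s :: "nat \<Rightarrow> 'a \<Rightarrow> real" where s: "\<And>i. simple_function ?R (s i)"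
    and lim: "\<And>x. x \<in> space ?R \<Longrightarrow> (\<lambda>i. s i x) \<longlonglongrightarrow> f x"
    using borel_measurable_implies_sequence_metric[OF f, of 0] by blast
  have "\<exists>A. A \<in> sets M \<and> s i -` {y} \<inter> space ?R = S \<inter> A" for i y
    using simple_functionD(2)[OF s, of i "{y}"] by (auto simp: sets_restrict_space)
  then obtain A where A [measurable]: "\<And>i y. A i y \<in> sets M"
    and A_eq: "\<And>i y. s i -` {y} \<inter> space ?R = S \<inter> A i y"
    by metis
  define t where "t i x = (\<Sum>y\<in>s i ` space ?R. y * indicator (A i y) x)" for i x
  have [measurable]: "t i \<in> borel_measurable M" for i
    unfolding t_def by measurable
  have t_eq: "t i x = s i x" if x: "x \<in> space M" "x \<in> S" for i x
  proof -
    have xR: "x \<in> space ?R"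
      using x by (simp add: space_restrict_space)
    have "indicator (A i y) x = (if y = s i x then 1 else (0::real))" for y
      using A_eq[of i y] x xR by (auto simp: indicator_def)
    then have "t i x = (\<Sum>y\<in>s i ` space ?R. if y = s i x then y else 0)"
      by (auto simp: t_def intro!: sum.cong)
    also have "\<dots> = s i x"
      using xR simple_functionD(1)[OF s, of i] by simp
    finally show ?thesis .
  qed
  show thesis
  proof
    show "(\<lambda>x. lim (\<lambda>i. t i x)) \<in> borel_measurable M"
      by (rule borel_measurable_lim_metric) simp
    show "lim (\<lambda>i. t i x) = f x" if x: "x \<in> space M" "x \<in> S" for x
      using lim[of x] x by (auto simp: t_eq space_restrict_space intro: limI)
  qed
qed

lemma mult_le_sum_squares: "\<bar>a\<bar> * \<bar>b\<bar> \<le> a\<^sup>2 + (b\<^sup>2 :: real)"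
  using sum_squares_bound[of "\<bar>a\<bar>" "\<bar>b\<bar>", unfolded power2_abs]
    mult_nonneg_nonneg[OF abs_ge_zero[of a] abs_ge_zero[of b]]
  by linarith

text \<open>
  For \<open>u = a + b\<close> this bounds \<open>\<bar>u\<^sup>2 - b\<^sup>2\<bar>\<close> with a free parameter \<open>t\<close>, in place of the
  Cauchy--Schwarz inequality for the integrals.
\<close>

lemma abs_square_plus_cross_le:
  fixes a b t :: real
  assumes "0 < t"
  shows "\<bar>a\<^sup>2 + 2 * (a * b)\<bar> \<le> (1 + 1 / t) * a\<^sup>2 + t * b\<^sup>2"
proof -
  have "2 * \<bar>a * b\<bar> = 2 * (\<bar>a\<bar> / sqrt t) * (sqrt t * \<bar>b\<bar>)"
    using assms by (simp add: abs_mult)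
  also have "\<dots> \<le> (\<bar>a\<bar> / sqrt t)\<^sup>2 + (sqrt t * \<bar>b\<bar>)\<^sup>2"
    by (rule sum_squares_bound)
  also have "\<dots> = 1 / t * a\<^sup>2 + t * b\<^sup>2"
    using assms by (simp add: power_divide power_mult_distrib)
  finally have "a\<^sup>2 + 2 * \<bar>a * b\<bar> \<le> (1 + 1 / t) * a\<^sup>2 + t * b\<^sup>2"
    by (simp add: distrib_right)
  moreover have "\<bar>a\<^sup>2 + 2 * (a * b)\<bar> \<le> \<bar>a\<^sup>2\<bar> + \<bar>2 * (a * b)\<bar>"
    by (rule abs_triangle_ineq)
  ultimately show ?thesis
    by (simp add: abs_mult)
qed

text \<open>
  With \<open>a, p\<close> and \<open>b, q\<close> the values of \<open>F, \<Phi>\<close> after and before a point is added, the left side is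
  the integrand of the functional carre du champ.
\<close>

lemma carre_du_champ_identity:
  fixes a b p q :: real
  shows "(a - b) * (a * p - b * q) - 1 / 2 * ((a\<^sup>2 - b\<^sup>2) * (p - q)) = (a - b)\<^sup>2 * (p + q) / 2"
  by (simp add: power2_eq_square field_simps)

section \<open>Poisson processes and the Mecke equation\<close>

locale poisson_process =
  fixes \<nu> :: "'z measure" and P :: "'z measure measure"
  assumes sigma_finite: "sigma_finite_measure \<nu>"
    and poisson: "poisson_law \<nu> P"
begin

sublocale intensity: sigma_finite_measure \<nu>
  by (rule sigma_finite)

sublocale law: prob_space P
  using poisson by (simp add: poisson_law_def)

sublocale pair_sigma_finite P \<nu> ..

lemma sets_law: "sets P = sets (point_measure_space \<nu>)"
  using poisson by (simp add: poisson_law_def)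

lemma space_law: "space P = point_measures \<nu>"
  using sets_eq_imp_space_eq[OF sets_law] by (simp add: space_point_measure_space)

lemma sets_config: "\<eta> \<in> space P \<Longrightarrow> sets \<eta> = sets \<nu>"
  by (simp add: space_law sets_point_measure)

lemma space_config: "\<eta> \<in> space P \<Longrightarrow> space \<eta> = space \<nu>"
  by (simp add: space_law space_point_measure)

lemma sets_law_pair: "sets (P \<Otimes>\<^sub>M \<nu>) = sets (point_measure_space \<nu> \<Otimes>\<^sub>M \<nu>)"
  by (intro sets_pair_measure_cong sets_law refl)

lemma measurable_emeasure_config [measurable]:
  "B \<in> sets \<nu> \<Longrightarrow> (\<lambda>\<eta>. emeasure \<eta> B) \<in> borel_measurable P"
  using measurable_emeasure_point_measure_space measurable_cong_sets[OF sets_law refl] by blast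

lemma add_point_in_space: "\<eta> \<in> space P \<Longrightarrow> add_point \<eta> z \<in> space P"
  by (simp add: space_law add_point_in_point_measures)

lemma measurable_add_point [measurable]: "(\<lambda>(\<eta>, z). add_point \<eta> z) \<in> P \<Otimes>\<^sub>M \<nu> \<rightarrow>\<^sub>M P"
proof -
  have "(\<lambda>(\<eta>, z). add_point \<eta> z) \<in> P \<Otimes>\<^sub>M \<nu> \<rightarrow>\<^sub>M point_measure_space \<nu>"
  proof (rule measurable_point_measure_spaceI)
    show "(\<lambda>(\<eta>, z). add_point \<eta> z) \<in> space (P \<Otimes>\<^sub>M \<nu>) \<rightarrow> point_measures \<nu>"
      by (auto simp: space_pair_measure space_law add_point_in_point_measures)
  next
    fix B assume B [measurable]: "B \<in> sets \<nu>"
    have "(\<lambda>(\<eta>, z). emeasure \<eta> B + indicator B z) \<in> borel_measurable (P \<Otimes>\<^sub>M \<nu>)"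
      by measurable
    also have "?this \<longleftrightarrow>
        (\<lambda>x. emeasure (case x of (\<eta>, z) \<Rightarrow> add_point \<eta> z) B) \<in> borel_measurable (P \<Otimes>\<^sub>M \<nu>)"
      using B by (intro measurable_cong)
        (auto simp: space_pair_measure emeasure_add_point sets_config)
    finally show "(\<lambda>x. emeasure (case x of (\<eta>, z) \<Rightarrow> add_point \<eta> z) B)
        \<in> borel_measurable (P \<Otimes>\<^sub>M \<nu>)" .
  qed
  then show ?thesis
    using measurable_cong_sets[OF refl sets_law] by blast
qed

lemma measurable_add_diff [measurable]:
  assumes [measurable]: "F \<in> borel_measurable P"
  shows "(\<lambda>x. add_diff F (snd x) (fst x)) \<in> borel_measurable (P \<Otimes>\<^sub>M \<nu>)"
  unfolding add_diff_def by measurable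

lemma mecke:
  assumes [measurable]: "u \<in> borel_measurable (P \<Otimes>\<^sub>M \<nu>)"
  shows "(\<integral>\<^sup>+\<eta>. (\<integral>\<^sup>+z. u (\<eta>, z) \<partial>\<eta>) \<partial>P) =
    (\<integral>\<^sup>+x. (u (add_point (fst x) (snd x), snd x) :: ennreal) \<partial>(P \<Otimes>\<^sub>M \<nu>))"
proof -
  have "u \<in> borel_measurable (point_measure_space \<nu> \<Otimes>\<^sub>M \<nu>)"
    using assms measurable_cong_sets[OF sets_law_pair refl] by blast
  then have "(\<integral>\<^sup>+\<eta>. (\<integral>\<^sup>+z. u (\<eta>, z) \<partial>\<eta>) \<partial>P) = (\<integral>\<^sup>+z. (\<integral>\<^sup>+\<eta>. u (add_point \<eta> z, z) \<partial>P) \<partial>\<nu>)"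
    using poisson by (simp add: poisson_law_def)
  also have "\<dots> = (\<integral>\<^sup>+x. u (add_point (fst x) (snd x), snd x) \<partial>(P \<Otimes>\<^sub>M \<nu>))"
    using nn_integral_snd[of "\<lambda>x. u (add_point (fst x) (snd x), snd x)"] by simp
  finally show ?thesis .
qed

text \<open>
  By the Mecke equation for the indicator of a null set: adding a point to a typical configuration
  gives a typical configuration.  It makes \<open>D\<^sup>+ F\<close> independent of the representative of \<open>F\<close>, and it
  transfers almost sure bounds from \<open>\<Phi>\<close> to its values after a point is added.
\<close>

lemma AE_add_point:
  assumes "AE \<eta> in P. Q \<eta>"
  shows "AE x in P \<Otimes>\<^sub>M \<nu>. Q (add_point (fst x) (snd x))"
proof -
  obtain N where N: "{\<eta>\<in>space P. \<not> Q \<eta>} \<subseteq> N" "N \<in> null_sets P"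
    using assms by (metis AE_E null_setsI)
  then have [measurable]: "N \<in> sets P"
    by auto
  have "(\<integral>\<^sup>+x. indicator N (add_point (fst x) (snd x)) \<partial>(P \<Otimes>\<^sub>M \<nu>)) =
      (\<integral>\<^sup>+\<eta>. (\<integral>\<^sup>+z. indicator N \<eta> \<partial>\<eta>) \<partial>P)"
    using mecke[of "\<lambda>x. indicator N (fst x)"] by simp
  also have "\<dots> = (\<integral>\<^sup>+\<eta>. 0 \<partial>P)"
    using AE_not_in[OF N(2)] by (intro nn_integral_cong_AE) (auto elim!: eventually_mono)
  finally have "(\<integral>\<^sup>+x. indicator N (add_point (fst x) (snd x)) \<partial>(P \<Otimes>\<^sub>M \<nu>)) = 0"
    by simp
  then have "AE x in P \<Otimes>\<^sub>M \<nu>. (indicator N (add_point (fst x) (snd x)) :: ennreal) = 0"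
    by (subst (asm) nn_integral_0_iff_AE) measurable
  then show ?thesis
  proof (rule AE_mp, intro AE_I2 impI)
    fix x assume x: "x \<in> space (P \<Otimes>\<^sub>M \<nu>)"
      "(indicator N (add_point (fst x) (snd x)) :: ennreal) = 0"
    then have "add_point (fst x) (snd x) \<in> space P"
      by (auto simp: space_pair_measure add_point_in_space)
    with x N(1) show "Q (add_point (fst x) (snd x))"
      by (auto simp: indicator_eq_0_iff)
  qed
qed

lemma AE_fst:
  assumes "AE \<eta> in P. Q \<eta>"
  shows "AE x in P \<Otimes>\<^sub>M \<nu>. Q (fst x)"
proof -
  obtain N where N: "{\<eta>\<in>space P. \<not> Q \<eta>} \<subseteq> N" "N \<in> null_sets P"
    using assms by (metis AE_E null_setsI)
  then have [measurable]: "N \<in> sets P"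
    by auto
  have "AE x in P \<Otimes>\<^sub>M \<nu>. fst x \<notin> N"
  proof (rule AE_pair_measure)
    show "{x \<in> space (P \<Otimes>\<^sub>M \<nu>). fst x \<notin> N} \<in> sets (P \<Otimes>\<^sub>M \<nu>)"
      by measurable
    show "AE \<eta> in P. AE z in \<nu>. fst (\<eta>, z) \<notin> N"
      by (rule AE_mp[OF AE_not_in[OF N(2)]]) simp
  qed
  then show ?thesis
    by (rule AE_mp, intro AE_I2 impI) (use N(1) in \<open>auto simp: space_pair_measure\<close>)
qed

text \<open>
  One exhaustion is fixed for all functionals, so that the configurations that are infinite on some
  cell form a single null set.
\<close>

definition window :: "nat \<Rightarrow> 'z set" where
  "window = (SOME D. range D \<subseteq> sets \<nu> \<and> disjoint_family D \<and> (\<Union>n. D n) = space \<nu> \<and>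
    (\<forall>n. emeasure \<nu> (D n) \<noteq> \<infinity>))"

lemma window: "range window \<subseteq> sets \<nu> \<and> disjoint_family window \<and> (\<Union>n. window n) = space \<nu> \<and>
    (\<forall>n. emeasure \<nu> (window n) \<noteq> \<infinity>)"
proof -
  obtain D :: "nat \<Rightarrow> 'z set" where "range D \<subseteq> sets \<nu>" "(\<Union>n. D n) = space \<nu>"
    "\<And>n. emeasure \<nu> (D n) \<noteq> \<infinity>" "disjoint_family D"
    by (rule intensity.sigma_finite_disjoint) (rule that)
  then have "\<exists>D :: nat \<Rightarrow> 'z set. range D \<subseteq> sets \<nu> \<and> disjoint_family D \<and> (\<Union>n. D n) = space \<nu> \<and>
      (\<forall>n. emeasure \<nu> (D n) \<noteq> \<infinity>)"
    by blast
  then show ?thesis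
    unfolding window_def by (rule someI_ex)
qed

lemma window_sets [measurable]: "window n \<in> sets \<nu>"
  and disjoint_window: "disjoint_family window"
  and UN_window: "(\<Union>n. window n) = space \<nu>"
  and window_finite: "emeasure \<nu> (window n) \<noteq> \<infinity>"
  using window by auto

lemma AE_window_finite: "AE \<eta> in P. \<forall>n. emeasure \<eta> (window n) \<noteq> \<infinity>"
proof (subst AE_all_countable, rule allI)
  fix n
  have "(\<integral>\<^sup>+\<eta>. emeasure \<eta> (window n) \<partial>P) = (\<integral>\<^sup>+\<eta>. (\<integral>\<^sup>+z. indicator (window n) z \<partial>\<eta>) \<partial>P)"
    by (intro nn_integral_cong) (simp add: sets_config)
  also have "\<dots> = (\<integral>\<^sup>+x. indicator (window n) (snd x) \<partial>(P \<Otimes>\<^sub>M \<nu>))"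
    using mecke[of "\<lambda>x. indicator (window n) (snd x)"] by simp
  also have "\<dots> = emeasure \<nu> (window n)"
    using intensity.nn_integral_fst[of "\<lambda>x. indicator (window n) (snd x)" P]
    by (simp add: law.emeasure_space_1)
  finally show "AE \<eta> in P. emeasure \<eta> (window n) \<noteq> \<infinity>"
    using window_finite[of n] by (intro nn_integral_noteq_infinite) auto
qed

lemma nn_integral_eq_suminf_window:
  assumes "sets \<eta> = sets \<nu>" "f \<in> borel_measurable \<nu>"
  shows "(\<integral>\<^sup>+z. f z \<partial>\<eta>) = (\<Sum>n. \<integral>\<^sup>+z. f z * indicator (window n) z \<partial>\<eta>)"
proof -
  have space: "space \<eta> = space \<nu>"
    using assms(1) by (rule sets_eq_imp_space_eq)
  have f: "f \<in> borel_measurable \<eta>"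
    using assms(2) measurable_cong_sets[OF assms(1) refl] by blast
  have "(\<integral>\<^sup>+z. f z \<partial>\<eta>) = (\<integral>\<^sup>+z. f z * indicator (\<Union>n. window n) z \<partial>\<eta>)"
    by (intro nn_integral_cong) (simp add: UN_window space)
  also have "\<dots> = (\<Sum>n. \<integral>\<^sup>+z. f z * indicator (window n) z \<partial>\<eta>)"
    using f disjoint_window assms(1) by (intro nn_integral_disjoint_family) auto
  finally show ?thesis .
qed

text \<open>
  A configuration is not \<open>\<sigma>\<close>-finite in a uniform way, so \<open>\<eta> \<mapsto> \<eta>\<close> is not a kernel to which the
  measurability theorems for subprobability kernels apply.  The normalised restrictions of \<open>\<eta>\<close> to
  the windows are such kernels, and almost surely the integral is recovered from them by multiplying
  back and summing up.
\<close>

lemma AE_measurable_nn_integral_config: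
  assumes u [measurable]: "u \<in> borel_measurable (P \<Otimes>\<^sub>M \<nu>)"
  obtains g :: "_ \<Rightarrow> ennreal" where "g \<in> borel_measurable P"
    and "AE \<eta> in P. (\<integral>\<^sup>+z. u (\<eta>, z) \<partial>\<eta>) = g \<eta>"
proof (cases "space \<nu> = {}")
  case True
  have "(\<integral>\<^sup>+z. u (\<eta>, z) \<partial>\<eta>) = 0" if "\<eta> \<in> space P" for \<eta>
    using True that by (subst nn_integral_cong[where v = "\<lambda>_. 0"]) (auto simp: space_config)
  then show thesis
    by (intro that[of "\<lambda>_. 0"]) auto
next
  case False
  \<comment> \<open>The conventions \<open>1 / 0 = \<infinity>\<close> and \<open>1 / \<infinity> = 0\<close> make this the zero measure if the window has mass \<open>0\<close> or \<open>\<infinity>\<close>.\<close>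
  define \<kappa> where "\<kappa> n \<eta> = density \<eta> (\<lambda>z. inverse (emeasure \<eta> (window n)) * indicator (window n) z)"
    for n \<eta>
  have \<kappa>_emeasure: "emeasure (\<kappa> n \<eta>) B = inverse (emeasure \<eta> (window n)) * emeasure \<eta> (window n \<inter> B)"
    if "\<eta> \<in> space P" "B \<in> sets \<nu>" for n \<eta> B
  proof -
    have [measurable]: "window n \<in> sets \<eta>" "B \<in> sets \<eta>"
      using that by (simp_all add: sets_config)
    show ?thesis
      unfolding \<kappa>_def
      by (simp add: emeasure_density mult.assoc indicator_inter_arith[symmetric]
          nn_integral_cmult_indicator)
  qed
  have \<kappa> [measurable]: "\<kappa> n \<in> P \<rightarrow>\<^sub>M subprob_algebra \<nu>" for n
  proof (rule measurable_subprob_algebra)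
    fix \<eta> assume \<eta>: "\<eta> \<in> space P"
    then show "sets (\<kappa> n \<eta>) = sets \<nu>"
      by (simp add: \<kappa>_def sets_config)
    have "inverse (emeasure \<eta> (window n)) * emeasure \<eta> (window n) \<le> 1"
      by (rule ennreal_inverse_mult_le_1)
    then show "subprob_space (\<kappa> n \<eta>)"
      using \<eta> False \<kappa>_emeasure[OF \<eta>, of "space \<nu>" n]
      by (intro subprob_spaceI) (auto simp: \<kappa>_def space_config Int_absorb2 sets.sets_into_space)
  next
    fix B assume [measurable]: "B \<in> sets \<nu>"
    then show "(\<lambda>\<eta>. emeasure (\<kappa> n \<eta>) B) \<in> borel_measurable P"
      by (subst measurable_cong[OF \<kappa>_emeasure]) auto
  qed
  define g where "g \<eta> = (\<Sum>n. emeasure \<eta> (window n) * (\<integral>\<^sup>+z. u (\<eta>, z) \<partial>\<kappa> n \<eta>))" for \<eta>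
  have "(\<lambda>\<eta>. \<integral>\<^sup>+z. u (\<eta>, z) \<partial>\<kappa> n \<eta>) \<in> borel_measurable P" for n
    by (rule nn_integral_measurable_subprob_algebra2[OF _ \<kappa>]) simp
  then have "g \<in> borel_measurable P"
    unfolding g_def by measurable
  moreover have "AE \<eta> in P. (\<integral>\<^sup>+z. u (\<eta>, z) \<partial>\<eta>) = g \<eta>"
    using AE_window_finite
  proof (rule AE_mp, intro AE_I2 impI)
    fix \<eta> assume \<eta>: "\<eta> \<in> space P" and fin: "\<forall>n. emeasure \<eta> (window n) \<noteq> \<infinity>"
    have u' [measurable]: "(\<lambda>z. u (\<eta>, z)) \<in> borel_measurable \<nu>"
      using \<eta> by measurable
    then have u'': "(\<lambda>z. u (\<eta>, z)) \<in> borel_measurable \<eta>"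
      using measurable_cong_sets[OF sets_config[OF \<eta>] refl] by blast
    have "(\<integral>\<^sup>+z. u (\<eta>, z) * indicator (window n) z \<partial>\<eta>) =
        emeasure \<eta> (window n) * (\<integral>\<^sup>+z. u (\<eta>, z) \<partial>\<kappa> n \<eta>)" for n
    proof (cases "emeasure \<eta> (window n) = 0")
      case True
      then have "AE z in \<eta>. z \<notin> window n"
        using \<eta> by (intro AE_not_in) (auto simp: sets_config)
      then have "(\<integral>\<^sup>+z. u (\<eta>, z) * indicator (window n) z \<partial>\<eta>) = (\<integral>\<^sup>+z. 0 \<partial>\<eta>)"
        by (intro nn_integral_cong_AE) (auto elim!: eventually_mono)
      with True show ?thesis
        by simp
    next
      case False
      have [measurable]: "window n \<in> sets \<eta>"
        using \<eta> by (simp add: sets_config)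
      have "(\<integral>\<^sup>+z. u (\<eta>, z) \<partial>\<kappa> n \<eta>) =
          (\<integral>\<^sup>+z. inverse (emeasure \<eta> (window n)) * (u (\<eta>, z) * indicator (window n) z) \<partial>\<eta>)"
        unfolding \<kappa>_def using u'' by (subst nn_integral_density) (auto simp: mult_ac)
      also have "\<dots> = inverse (emeasure \<eta> (window n)) *
          (\<integral>\<^sup>+z. u (\<eta>, z) * indicator (window n) z \<partial>\<eta>)"
        using u'' by (intro nn_integral_cmult) auto
      finally have "emeasure \<eta> (window n) * (\<integral>\<^sup>+z. u (\<eta>, z) \<partial>\<kappa> n \<eta>) =
          (emeasure \<eta> (window n) * inverse (emeasure \<eta> (window n))) *
          (\<integral>\<^sup>+z. u (\<eta>, z) * indicator (window n) z \<partial>\<eta>)"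
        by (simp add: mult.assoc)
      also have "emeasure \<eta> (window n) * inverse (emeasure \<eta> (window n)) = 1"
        using False fin ennreal_divide_self[of "emeasure \<eta> (window n)"]
        by (simp add: divide_ennreal_def less_top)
      finally show ?thesis
        by simp
    qed
    then show "(\<integral>\<^sup>+z. u (\<eta>, z) \<partial>\<eta>) = g \<eta>"
      unfolding g_def using nn_integral_eq_suminf_window[OF sets_config[OF \<eta>] u'] by simp
  qed
  ultimately show thesis
    by (rule that)
qed

section \<open>Versions of the drop operator\<close>

text \<open>
  On the pairs for which \<open>\<eta> - \<delta>\<^sub>z\<close> is again a point measure, subtraction of the point is measurable
  for the trace \<open>\<sigma>\<close>-algebra, because the counts \<open>\<eta>(B) - 1\<^sub>B(z)\<close> are restrictions of jointly
  measurable functions.  The composition with \<open>F\<close> then extends to all pairs.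
\<close>

lemma ex_drop_diff_version:
  assumes F [measurable]: "F \<in> borel_measurable P"
  shows "\<exists>w. drop_diff_version \<nu> P F w"
proof -
  define S where "S = {(\<eta>, z). (\<forall>n. emeasure \<eta> (window n) \<noteq> \<infinity>) \<and> has_point \<eta> z}"
  let ?R = "restrict_space (P \<Otimes>\<^sub>M \<nu>) S"
  have "(\<lambda>x. drop_point (fst x) (snd x)) \<in> ?R \<rightarrow>\<^sub>M point_measure_space \<nu>"
  proof (rule measurable_point_measure_spaceI)
    show "(\<lambda>x. drop_point (fst x) (snd x)) \<in> space ?R \<rightarrow> point_measures \<nu>"
      using window by (auto simp: space_restrict_space space_pair_measure S_def space_law
          intro!: drop_point_in_point_measures[where D = window])
  next
    fix B assume B [measurable]: "B \<in> sets \<nu>"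
    have "(\<lambda>x. emeasure (fst x) B - indicator B (snd x)) \<in> borel_measurable ?R"
      by (rule measurable_restrict_space1) measurable
    also have "?this \<longleftrightarrow> (\<lambda>x. emeasure (drop_point (fst x) (snd x)) B) \<in> borel_measurable ?R"
      using B by (intro measurable_cong)
        (auto simp: space_restrict_space space_pair_measure S_def emeasure_drop_point sets_config)
    finally show "(\<lambda>x. emeasure (drop_point (fst x) (snd x)) B) \<in> borel_measurable ?R" .
  qed
  then have "(\<lambda>x. drop_point (fst x) (snd x)) \<in> ?R \<rightarrow>\<^sub>M P"
    using measurable_cong_sets[OF refl sets_law] by blast
  then have "(\<lambda>x. F (drop_point (fst x) (snd x))) \<in> borel_measurable ?R"
    using F by (rule measurable_compose)
  then obtain g where g [measurable]: "g \<in> borel_measurable (P \<Otimes>\<^sub>M \<nu>)"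
    and g_eq: "\<And>x. x \<in> space (P \<Otimes>\<^sub>M \<nu>) \<Longrightarrow> x \<in> S \<Longrightarrow> g x = F (drop_point (fst x) (snd x))"
    by (rule borel_measurable_restrict_space_extend) blast
  have "drop_diff_version \<nu> P F (\<lambda>x. F (fst x) - g x)"
    unfolding drop_diff_version_def
  proof
    show "(\<lambda>x. F (fst x) - g x) \<in> borel_measurable (P \<Otimes>\<^sub>M \<nu>)"
      by measurable
    show "AE \<eta> in P. \<forall>z\<in>space \<nu>. has_point \<eta> z \<longrightarrow>
        F (fst (\<eta>, z)) - g (\<eta>, z) = drop_diff F z \<eta>"
      using AE_window_finite
      by (rule AE_mp, intro AE_I2) (auto simp: drop_diff_def g_eq S_def space_pair_measure)
  qed
  then show ?thesis
    by blast
qed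

abbreviation shift :: "'z measure \<times> 'z \<Rightarrow> 'z measure" where
  "shift x \<equiv> add_point (fst x) (snd x)"

abbreviation grad :: "('z measure \<Rightarrow> real) \<Rightarrow> 'z measure \<times> 'z \<Rightarrow> real" where
  "grad F x \<equiv> add_diff F (snd x) (fst x)"

text \<open>
  The right side of the Mecke equation evaluates \<open>w\<close> at pairs \<open>(\<eta> + \<delta>\<^sub>z, z)\<close>, where the added point is
  present, so there all versions agree.
\<close>

lemma AE_drop_diff_version_shift:
  assumes "drop_diff_version \<nu> P F w"
  shows "AE x in P \<Otimes>\<^sub>M \<nu>. w (shift x, snd x) = grad F x"
proof -
  have "AE \<eta> in P. \<forall>z\<in>space \<nu>. has_point \<eta> z \<longrightarrow> w (\<eta>, z) = drop_diff F z \<eta>"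
    using assms by (simp add: drop_diff_version_def)
  from AE_add_point[OF this] show ?thesis
    by (rule AE_mp, intro AE_I2)
      (auto simp: space_pair_measure has_point_add_point drop_diff_add_point)
qed

section \<open>The density of the carre du champ\<close>

definition gamma_integral where
  "gamma_integral F w \<eta> =
    (\<integral>\<^sup>+z. ennreal ((add_diff F z \<eta>)\<^sup>2) \<partial>\<nu>) / 2 + (\<integral>\<^sup>+z. ennreal ((w (\<eta>, z))\<^sup>2) \<partial>\<eta>) / 2"

text \<open>
  The Mecke equation, applied to \<open>w\<^sup>2 \<phi>\<close>, turns the integral of the squared drop operator against
  \<open>\<eta>\<close> into one of the squared add operator with \<open>\<phi>\<close> evaluated after the point is added.  The
  function \<open>\<gamma>\<close> stands in for \<open>gamma_integral F w\<close>, which itself need not be measurable.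
\<close>

lemma ex_measurable_gamma_integral:
  assumes F [measurable]: "F \<in> borel_measurable P" and w: "drop_diff_version \<nu> P F w"
  obtains \<gamma> :: "_ \<Rightarrow> ennreal" where "\<gamma> \<in> borel_measurable P"
    and "AE \<eta> in P. gamma_integral F w \<eta> = \<gamma> \<eta>"
    and "\<And>\<phi>. \<phi> \<in> borel_measurable P \<Longrightarrow> (\<integral>\<^sup>+\<eta>. \<gamma> \<eta> * \<phi> \<eta> \<partial>P) =
      (\<integral>\<^sup>+x. ennreal ((grad F x)\<^sup>2) * (\<phi> (fst x) + \<phi> (shift x)) \<partial>(P \<Otimes>\<^sub>M \<nu>)) / 2"
proof -
  have w_meas [measurable]: "w \<in> borel_measurable (P \<Otimes>\<^sub>M \<nu>)"
    using w by (simp add: drop_diff_version_def)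
  define h where "h \<eta> = (\<integral>\<^sup>+z. ennreal ((add_diff F z \<eta>)\<^sup>2) \<partial>\<nu>)" for \<eta>
  have h_meas [measurable]: "h \<in> borel_measurable P"
    unfolding h_def
    using intensity.borel_measurable_nn_integral_fst[of "\<lambda>x. ennreal ((grad F x)\<^sup>2)" P] by simp
  obtain g :: "_ \<Rightarrow> ennreal" where g_meas [measurable]: "g \<in> borel_measurable P"
    and g: "AE \<eta> in P. (\<integral>\<^sup>+z. ennreal ((w (\<eta>, z))\<^sup>2) \<partial>\<eta>) = g \<eta>"
    using AE_measurable_nn_integral_config[of "\<lambda>x. ennreal ((w x)\<^sup>2)"] by auto
  show thesis
  proof
    show "(\<lambda>\<eta>. h \<eta> / 2 + g \<eta> / 2) \<in> borel_measurable P"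
      by measurable
    show "AE \<eta> in P. gamma_integral F w \<eta> = h \<eta> / 2 + g \<eta> / 2"
      using g by (auto simp: gamma_integral_def h_def)
    fix \<phi> :: "_ \<Rightarrow> ennreal" assume \<phi> [measurable]: "\<phi> \<in> borel_measurable P"
    have "(\<integral>\<^sup>+\<eta>. h \<eta> * \<phi> \<eta> \<partial>P) = (\<integral>\<^sup>+\<eta>. \<integral>\<^sup>+z. ennreal ((add_diff F z \<eta>)\<^sup>2) * \<phi> \<eta> \<partial>\<nu> \<partial>P)"
    proof (rule nn_integral_cong)
      fix \<eta> assume [simp, measurable]: "\<eta> \<in> space P"
      have "(\<lambda>z. ennreal ((grad F (\<eta>, z))\<^sup>2)) \<in> borel_measurable \<nu>"
        by (rule measurable_compose_Pair1[of \<eta> P]) measurable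
      then show "h \<eta> * \<phi> \<eta> = (\<integral>\<^sup>+z. ennreal ((add_diff F z \<eta>)\<^sup>2) * \<phi> \<eta> \<partial>\<nu>)"
        by (simp add: h_def nn_integral_multc)
    qed
    also have "\<dots> = (\<integral>\<^sup>+x. ennreal ((grad F x)\<^sup>2) * \<phi> (fst x) \<partial>(P \<Otimes>\<^sub>M \<nu>))"
      using intensity.nn_integral_fst[of "\<lambda>x. ennreal ((grad F x)\<^sup>2) * \<phi> (fst x)" P] by simp
    finally have h: "(\<integral>\<^sup>+\<eta>. h \<eta> * \<phi> \<eta> \<partial>P) = \<dots>" .
    have "(\<integral>\<^sup>+\<eta>. g \<eta> * \<phi> \<eta> \<partial>P) = (\<integral>\<^sup>+\<eta>. (\<integral>\<^sup>+z. ennreal ((w (\<eta>, z))\<^sup>2) \<partial>\<eta>) * \<phi> \<eta> \<partial>P)"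
      using g by (intro nn_integral_cong_AE) auto
    also have "\<dots> = (\<integral>\<^sup>+\<eta>. (\<integral>\<^sup>+z. ennreal ((w (\<eta>, z))\<^sup>2) * \<phi> \<eta> \<partial>\<eta>) \<partial>P)"
    proof (rule nn_integral_cong)
      fix \<eta> assume \<eta>: "\<eta> \<in> space P"
      have "(\<lambda>z. ennreal ((w (\<eta>, z))\<^sup>2)) \<in> borel_measurable \<nu>"
        by (rule measurable_compose_Pair1[OF \<eta>]) measurable
      then have "(\<lambda>z. ennreal ((w (\<eta>, z))\<^sup>2)) \<in> borel_measurable \<eta>"
        using measurable_cong_sets[OF sets_config[OF \<eta>] refl] by blast
      then show "(\<integral>\<^sup>+z. ennreal ((w (\<eta>, z))\<^sup>2) \<partial>\<eta>) * \<phi> \<eta> =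
          (\<integral>\<^sup>+z. ennreal ((w (\<eta>, z))\<^sup>2) * \<phi> \<eta> \<partial>\<eta>)"
        by (simp add: nn_integral_multc)
    qed
    also have "\<dots> = (\<integral>\<^sup>+x. ennreal ((w (shift x, snd x))\<^sup>2) * \<phi> (shift x) \<partial>(P \<Otimes>\<^sub>M \<nu>))"
      using mecke[of "\<lambda>x. ennreal ((w x)\<^sup>2) * \<phi> (fst x)"] by simp
    also have "\<dots> = (\<integral>\<^sup>+x. ennreal ((grad F x)\<^sup>2) * \<phi> (shift x) \<partial>(P \<Otimes>\<^sub>M \<nu>))"
      using AE_drop_diff_version_shift[OF w] by (intro nn_integral_cong_AE) auto
    finally have g: "(\<integral>\<^sup>+\<eta>. g \<eta> * \<phi> \<eta> \<partial>P) = \<dots>" .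
    have "(\<integral>\<^sup>+\<eta>. (h \<eta> / 2 + g \<eta> / 2) * \<phi> \<eta> \<partial>P) = (\<integral>\<^sup>+\<eta>. (h \<eta> * \<phi> \<eta> + g \<eta> * \<phi> \<eta>) / 2 \<partial>P)"
      by (intro nn_integral_cong) (simp add: divide_ennreal_def distrib_left mult_ac)
    also have "\<dots> = ((\<integral>\<^sup>+\<eta>. h \<eta> * \<phi> \<eta> \<partial>P) + (\<integral>\<^sup>+\<eta>. g \<eta> * \<phi> \<eta> \<partial>P)) / 2"
      by (simp add: nn_integral_divide nn_integral_add)
    also have "\<dots> = (\<integral>\<^sup>+x. ennreal ((grad F x)\<^sup>2) * (\<phi> (fst x) + \<phi> (shift x)) \<partial>(P \<Otimes>\<^sub>M \<nu>)) / 2"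
      unfolding h g by (subst nn_integral_add[symmetric]) (auto simp: distrib_left)
    finally show "(\<integral>\<^sup>+\<eta>. (h \<eta> / 2 + g \<eta> / 2) * \<phi> \<eta> \<partial>P) =
        (\<integral>\<^sup>+x. ennreal ((grad F x)\<^sup>2) * (\<phi> (fst x) + \<phi> (shift x)) \<partial>(P \<Otimes>\<^sub>M \<nu>)) / 2" .
  qed
qed

section \<open>The carre du champ as a weighted energy\<close>

lemma Dom_D_iff:
  "F \<in> Dom_D \<nu> P \<longleftrightarrow> F \<in> borel_measurable P \<and> integrable P (\<lambda>\<eta>. (F \<eta>)\<^sup>2) \<and>
    integrable (P \<Otimes>\<^sub>M \<nu>) (\<lambda>x. (grad F x)\<^sup>2)"
proof (cases "F \<in> borel_measurable P")
  case True
  note [measurable] = True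
  have "(\<integral>\<^sup>+z. (\<integral>\<^sup>+\<eta>. ennreal ((add_diff F z \<eta>)\<^sup>2) \<partial>P) \<partial>\<nu>) =
      (\<integral>\<^sup>+x. ennreal ((grad F x)\<^sup>2) \<partial>(P \<Otimes>\<^sub>M \<nu>))"
    using nn_integral_snd[of "\<lambda>x. ennreal ((grad F x)\<^sup>2)"] by simp
  then show ?thesis
    by (simp add: Dom_D_def integrable_iff_bounded)
qed (simp add: Dom_D_def)

lemma Dom_D_measurable: "F \<in> Dom_D \<nu> P \<Longrightarrow> F \<in> borel_measurable P"
  and Dom_D_square: "F \<in> Dom_D \<nu> P \<Longrightarrow> integrable P (\<lambda>\<eta>. (F \<eta>)\<^sup>2)"
  and Dom_D_grad: "F \<in> Dom_D \<nu> P \<Longrightarrow> integrable (P \<Otimes>\<^sub>M \<nu>) (\<lambda>x. (grad F x)\<^sup>2)"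
  by (simp_all add: Dom_D_iff)

lemma dirichlet_form_eq: "dirichlet_form \<nu> P F G = (\<integral>x. grad F x * grad G x \<partial>(P \<Otimes>\<^sub>M \<nu>))"
  by (simp add: dirichlet_form_def case_prod_beta')

lemma bounded_Dom_D_bound:
  assumes "\<Phi> \<in> bounded_Dom_D \<nu> P"
  obtains c where "0 \<le> c" "AE \<eta> in P. \<bar>\<Phi> \<eta>\<bar> \<le> c"
    "AE x in P \<Otimes>\<^sub>M \<nu>. \<bar>\<Phi> (fst x)\<bar> \<le> c \<and> \<bar>\<Phi> (shift x)\<bar> \<le> c"
proof -
  obtain c where "AE \<eta> in P. \<bar>\<Phi> \<eta>\<bar> \<le> c"
    using assms by (auto simp: bounded_Dom_D_def)
  then have c: "AE \<eta> in P. \<bar>\<Phi> \<eta>\<bar> \<le> \<bar>c\<bar>"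
    by (rule AE_mp) auto
  from that[OF _ c] AE_fst[OF c] AE_add_point[OF c] show thesis
    by auto
qed

text \<open>
  The value of the functional carre du champ; unlike the original expression it makes sense for
  unbounded \<open>F\<close>.
\<close>

definition weighted_energy where
  "weighted_energy F \<Phi> = (\<integral>x. (grad F x)\<^sup>2 * (\<Phi> (fst x) + \<Phi> (shift x)) \<partial>(P \<Otimes>\<^sub>M \<nu>)) / 2"

lemma integrable_weighted_energy:
  assumes F: "F \<in> Dom_D \<nu> P" and \<Phi> [measurable]: "\<Phi> \<in> borel_measurable P"
    and c: "AE x in P \<Otimes>\<^sub>M \<nu>. \<bar>\<Phi> (fst x)\<bar> \<le> c \<and> \<bar>\<Phi> (shift x)\<bar> \<le> c"
  shows "integrable (P \<Otimes>\<^sub>M \<nu>) (\<lambda>x. (grad F x)\<^sup>2 * (\<Phi> (fst x) + \<Phi> (shift x)))"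
proof (rule Bochner_Integration.integrable_bound)
  note [measurable] = Dom_D_measurable[OF F]
  show "integrable (P \<Otimes>\<^sub>M \<nu>) (\<lambda>x. (grad F x)\<^sup>2 * (2 * c))"
    using Dom_D_grad[OF F] by simp
  show "(\<lambda>x. (grad F x)\<^sup>2 * (\<Phi> (fst x) + \<Phi> (shift x))) \<in> borel_measurable (P \<Otimes>\<^sub>M \<nu>)"
    by measurable
  show "AE x in P \<Otimes>\<^sub>M \<nu>. norm ((grad F x)\<^sup>2 * (\<Phi> (fst x) + \<Phi> (shift x))) \<le>
      norm ((grad F x)\<^sup>2 * (2 * c))"
    using c
  proof (rule AE_mp, intro AE_I2 impI)
    fix x assume "\<bar>\<Phi> (fst x)\<bar> \<le> c \<and> \<bar>\<Phi> (shift x)\<bar> \<le> c"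
    then have "\<bar>\<Phi> (fst x) + \<Phi> (shift x)\<bar> \<le> \<bar>2 * c\<bar>"
      by linarith
    then show "norm ((grad F x)\<^sup>2 * (\<Phi> (fst x) + \<Phi> (shift x))) \<le> norm ((grad F x)\<^sup>2 * (2 * c))"
      by (simp only: real_norm_def abs_mult) (intro mult_left_mono, simp_all)
  qed
qed

text \<open>
  Under the integral this is \<open>carre_du_champ_identity\<close>.  Boundedness of \<open>F\<close> and \<open>\<Phi>\<close>, before and
  after adding a point, gives the integrability that allows the two Dirichlet forms to be combined.
\<close>

lemma carre_form_bounded_eq:
  assumes F: "F \<in> bounded_Dom_D \<nu> P" and \<Phi>: "\<Phi> \<in> bounded_Dom_D \<nu> P"
  shows "carre_form_bounded \<nu> P F \<Phi> = weighted_energy F \<Phi>"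
proof -
  have F': "F \<in> Dom_D \<nu> P" and \<Phi>': "\<Phi> \<in> Dom_D \<nu> P"
    using F \<Phi> by (auto simp: bounded_Dom_D_def)
  note [measurable] = Dom_D_measurable[OF F'] Dom_D_measurable[OF \<Phi>']
  note grads = Dom_D_grad[OF F'] Dom_D_grad[OF \<Phi>']
  obtain k where k: "0 \<le> k" "AE x in P \<Otimes>\<^sub>M \<nu>. \<bar>F (fst x)\<bar> \<le> k \<and> \<bar>F (shift x)\<bar> \<le> k"
    using F by (rule bounded_Dom_D_bound)
  obtain c where c: "0 \<le> c" "AE x in P \<Otimes>\<^sub>M \<nu>. \<bar>\<Phi> (fst x)\<bar> \<le> c \<and> \<bar>\<Phi> (shift x)\<bar> \<le> c"
    using \<Phi> by (rule bounded_Dom_D_bound)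
  have int1: "integrable (P \<Otimes>\<^sub>M \<nu>) (\<lambda>x. grad F x * grad (\<lambda>\<eta>. F \<eta> * \<Phi> \<eta>) x)"
  proof (rule Bochner_Integration.integrable_bound)
    show "integrable (P \<Otimes>\<^sub>M \<nu>) (\<lambda>x. c * (grad F x)\<^sup>2 + k * ((grad F x)\<^sup>2 + (grad \<Phi> x)\<^sup>2))"
      using grads by simp
    show "AE x in P \<Otimes>\<^sub>M \<nu>. norm (grad F x * grad (\<lambda>\<eta>. F \<eta> * \<Phi> \<eta>) x) \<le>
        norm (c * (grad F x)\<^sup>2 + k * ((grad F x)\<^sup>2 + (grad \<Phi> x)\<^sup>2))"
      using k(2) c(2)
    proof (elim AE_mp, intro AE_I2 impI)
      fix x assume *: "\<bar>F (fst x)\<bar> \<le> k \<and> \<bar>F (shift x)\<bar> \<le> k"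
        "\<bar>\<Phi> (fst x)\<bar> \<le> c \<and> \<bar>\<Phi> (shift x)\<bar> \<le> c"
      \<comment> \<open>In this form of the product rule every factor beside the two gradients is bounded.\<close>
      have "grad F x * grad (\<lambda>\<eta>. F \<eta> * \<Phi> \<eta>) x =
          \<Phi> (shift x) * (grad F x)\<^sup>2 + F (fst x) * (grad F x * grad \<Phi> x)"
        by (simp add: add_diff_def power2_eq_square algebra_simps)
      also have "\<bar>\<dots>\<bar> \<le> \<bar>\<Phi> (shift x)\<bar> * (grad F x)\<^sup>2 + \<bar>F (fst x)\<bar> * (\<bar>grad F x\<bar> * \<bar>grad \<Phi> x\<bar>)"
        by (rule order_trans[OF abs_triangle_ineq]) (simp add: abs_mult)
      also have "\<dots> \<le> c * (grad F x)\<^sup>2 + k * ((grad F x)\<^sup>2 + (grad \<Phi> x)\<^sup>2)"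
        using * k(1) by (intro add_mono mult_mono mult_le_sum_squares) auto
      finally show "norm (grad F x * grad (\<lambda>\<eta>. F \<eta> * \<Phi> \<eta>) x) \<le>
          norm (c * (grad F x)\<^sup>2 + k * ((grad F x)\<^sup>2 + (grad \<Phi> x)\<^sup>2))"
        by simp
    qed
  qed measurable
  have int2: "integrable (P \<Otimes>\<^sub>M \<nu>) (\<lambda>x. grad (\<lambda>\<eta>. (F \<eta>)\<^sup>2) x * grad \<Phi> x)"
  proof (rule Bochner_Integration.integrable_bound)
    show "integrable (P \<Otimes>\<^sub>M \<nu>) (\<lambda>x. (2 * k) * ((grad F x)\<^sup>2 + (grad \<Phi> x)\<^sup>2))"
      using grads by simp
    show "AE x in P \<Otimes>\<^sub>M \<nu>. norm (grad (\<lambda>\<eta>. (F \<eta>)\<^sup>2) x * grad \<Phi> x) \<le>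
        norm ((2 * k) * ((grad F x)\<^sup>2 + (grad \<Phi> x)\<^sup>2))"
      using k(2)
    proof (rule AE_mp, intro AE_I2 impI)
      fix x assume *: "\<bar>F (fst x)\<bar> \<le> k \<and> \<bar>F (shift x)\<bar> \<le> k"
      have "\<bar>grad (\<lambda>\<eta>. (F \<eta>)\<^sup>2) x * grad \<Phi> x\<bar> =
          \<bar>F (fst x) + F (shift x)\<bar> * (\<bar>grad F x\<bar> * \<bar>grad \<Phi> x\<bar>)"
        by (simp add: add_diff_def power2_eq_square algebra_simps flip: abs_mult)
      also have "\<dots> \<le> (2 * k) * ((grad F x)\<^sup>2 + (grad \<Phi> x)\<^sup>2)"
      proof (rule mult_mono[OF _ mult_le_sum_squares])
        show "\<bar>F (fst x) + F (shift x)\<bar> \<le> 2 * k"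
          using * by linarith
      qed (use k(1) in simp_all)
      finally show "norm (grad (\<lambda>\<eta>. (F \<eta>)\<^sup>2) x * grad \<Phi> x) \<le>
          norm ((2 * k) * ((grad F x)\<^sup>2 + (grad \<Phi> x)\<^sup>2))"
        by simp
    qed
  qed measurable
  have "carre_form_bounded \<nu> P F \<Phi> = (\<integral>x. grad F x * grad (\<lambda>\<eta>. F \<eta> * \<Phi> \<eta>) x -
      1 / 2 * (grad (\<lambda>\<eta>. (F \<eta>)\<^sup>2) x * grad \<Phi> x) \<partial>(P \<Otimes>\<^sub>M \<nu>))"
    using int1 int2 by (simp add: carre_form_bounded_def dirichlet_form_eq)
  also have "\<dots> = (\<integral>x. (grad F x)\<^sup>2 * (\<Phi> (fst x) + \<Phi> (shift x)) / 2 \<partial>(P \<Otimes>\<^sub>M \<nu>))"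
    unfolding add_diff_def carre_du_champ_identity
    by (simp only: add.commute)
  finally show ?thesis
    by (simp add: weighted_energy_def)
qed

lemma Dom_D_diff:
  assumes H: "H \<in> Dom_D \<nu> P" and F: "F \<in> Dom_D \<nu> P"
  shows "(\<lambda>\<eta>. H \<eta> - F \<eta>) \<in> Dom_D \<nu> P"
proof -
  note [measurable] = Dom_D_measurable[OF F] Dom_D_measurable[OF H]
  have sq: "norm ((a - b)\<^sup>2) \<le> norm (2 * (a\<^sup>2 + (b\<^sup>2 :: real)))" for a b
  proof -
    have "(a - b)\<^sup>2 \<le> 2 * (a\<^sup>2 + b\<^sup>2)"
      using zero_le_power2[of "a + b"] by (simp add: power2_eq_square algebra_simps)
    then show ?thesis
      by simp
  qed
  have "integrable P (\<lambda>\<eta>. (H \<eta> - F \<eta>)\<^sup>2)"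
    by (rule Bochner_Integration.integrable_bound[of _ "\<lambda>\<eta>. 2 * ((H \<eta>)\<^sup>2 + (F \<eta>)\<^sup>2)"])
      (use Dom_D_square[OF F] Dom_D_square[OF H] sq in \<open>auto simp del: real_norm_def\<close>)
  moreover have "integrable (P \<Otimes>\<^sub>M \<nu>) (\<lambda>x. (grad H x - grad F x)\<^sup>2)"
    by (rule Bochner_Integration.integrable_bound[of _ "\<lambda>x. 2 * ((grad H x)\<^sup>2 + (grad F x)\<^sup>2)"])
      (use Dom_D_grad[OF F] Dom_D_grad[OF H] sq in \<open>auto simp del: real_norm_def\<close>)
  moreover have "grad (\<lambda>\<eta>. H \<eta> - F \<eta>) x = grad H x - grad F x" for x
    by (simp add: add_diff_def)
  ultimately show ?thesis
    by (simp add: Dom_D_iff)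
qed

text \<open>
  The parameter \<open>t\<close> is chosen small first, which makes the last term small; then the first term
  vanishes as \<open>H\<close> approaches \<open>F\<close> in the Dirichlet norm.
\<close>

lemma weighted_energy_diff_bound:
  assumes H: "H \<in> Dom_D \<nu> P" and F: "F \<in> Dom_D \<nu> P"
    and \<Phi> [measurable]: "\<Phi> \<in> borel_measurable P" and "0 \<le> c" "0 < t"
    and c: "AE x in P \<Otimes>\<^sub>M \<nu>. \<bar>\<Phi> (fst x)\<bar> \<le> c \<and> \<bar>\<Phi> (shift x)\<bar> \<le> c"
  shows "\<bar>weighted_energy H \<Phi> - weighted_energy F \<Phi>\<bar> \<le>
    c * ((1 + 1 / t) * (dirichlet_norm \<nu> P (\<lambda>\<eta>. H \<eta> - F \<eta>))\<^sup>2 + t * dirichlet_form \<nu> P F F)"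
proof -
  let ?\<Psi> = "\<lambda>x. \<Phi> (fst x) + \<Phi> (shift x)"
  let ?HF = "\<lambda>\<eta>. H \<eta> - F \<eta>"
  have HF: "?HF \<in> Dom_D \<nu> P"
    using H F by (rule Dom_D_diff)
  note [measurable] = Dom_D_measurable[OF F] Dom_D_measurable[OF H]
  note intH = integrable_weighted_energy[OF H \<Phi> c] and intF = integrable_weighted_energy[OF F \<Phi> c]
  have E: "dirichlet_form \<nu> P ?HF ?HF \<le> (dirichlet_norm \<nu> P ?HF)\<^sup>2"
    by (simp add: dirichlet_norm_def dirichlet_form_eq)
  have "2 * (weighted_energy H \<Phi> - weighted_energy F \<Phi>) =
      (\<integral>x. (grad H x)\<^sup>2 * ?\<Psi> x - (grad F x)\<^sup>2 * ?\<Psi> x \<partial>(P \<Otimes>\<^sub>M \<nu>))"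
    using intH intF by (simp add: weighted_energy_def)
  also have "\<bar>\<dots>\<bar> \<le> (\<integral>x. (2 * c) * ((1 + 1 / t) * (grad ?HF x)\<^sup>2 + t * (grad F x)\<^sup>2) \<partial>(P \<Otimes>\<^sub>M \<nu>))"
  proof (rule order_trans[OF integral_abs_bound], rule integral_mono_AE)
    show "integrable (P \<Otimes>\<^sub>M \<nu>) (\<lambda>x. \<bar>(grad H x)\<^sup>2 * ?\<Psi> x - (grad F x)\<^sup>2 * ?\<Psi> x\<bar>)"
      using intH intF by simp
    show "integrable (P \<Otimes>\<^sub>M \<nu>)
        (\<lambda>x. (2 * c) * ((1 + 1 / t) * (grad ?HF x)\<^sup>2 + t * (grad F x)\<^sup>2))"
      using Dom_D_grad[OF F] Dom_D_grad[OF HF] by simp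
    show "AE x in P \<Otimes>\<^sub>M \<nu>. \<bar>(grad H x)\<^sup>2 * ?\<Psi> x - (grad F x)\<^sup>2 * ?\<Psi> x\<bar> \<le>
        (2 * c) * ((1 + 1 / t) * (grad ?HF x)\<^sup>2 + t * (grad F x)\<^sup>2)"
      using c
    proof (rule AE_mp, intro AE_I2 impI)
      fix x assume *: "\<bar>\<Phi> (fst x)\<bar> \<le> c \<and> \<bar>\<Phi> (shift x)\<bar> \<le> c"
      define a b where "a = grad ?HF x" and "b = grad F x"
      have "grad H x = a + b"
        by (simp add: a_def b_def add_diff_def)
      then have "(grad H x)\<^sup>2 * ?\<Psi> x - (grad F x)\<^sup>2 * ?\<Psi> x = ?\<Psi> x * (a\<^sup>2 + 2 * (a * b))"
        by (simp add: b_def[symmetric] power2_eq_square algebra_simps)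
      also have "\<bar>\<dots>\<bar> \<le> (2 * c) * \<bar>a\<^sup>2 + 2 * (a * b)\<bar>"
        unfolding abs_mult using * by (intro mult_right_mono) auto
      also have "\<bar>a\<^sup>2 + 2 * (a * b)\<bar> \<le> (1 + 1 / t) * a\<^sup>2 + t * b\<^sup>2"
        using \<open>0 < t\<close> by (rule abs_square_plus_cross_le)
      finally show "\<bar>(grad H x)\<^sup>2 * ?\<Psi> x - (grad F x)\<^sup>2 * ?\<Psi> x\<bar> \<le>
          (2 * c) * ((1 + 1 / t) * (grad ?HF x)\<^sup>2 + t * (grad F x)\<^sup>2)"
        using \<open>0 \<le> c\<close> by (simp add: a_def b_def mult_left_mono)
    qed
  qed
  also have "\<dots> = (2 * c) * ((1 + 1 / t) * dirichlet_form \<nu> P ?HF ?HF + t * dirichlet_form \<nu> P F F)"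
    using Dom_D_grad[OF F] Dom_D_grad[OF HF] by (simp add: dirichlet_form_eq power2_eq_square)
  also have "\<dots> \<le> (2 * c) * ((1 + 1 / t) * (dirichlet_norm \<nu> P ?HF)\<^sup>2 + t * dirichlet_form \<nu> P F F)"
    using \<open>0 \<le> c\<close> \<open>0 < t\<close> E by (intro mult_left_mono add_right_mono) auto
  finally show ?thesis
    by (simp add: abs_mult)
qed

text \<open>
  Clamping to \<open>[-n, n]\<close> is a contraction, so it increases neither \<open>\<bar>F\<bar>\<close> nor \<open>\<bar>D\<^sup>+ F\<bar>\<close>, and dominated
  convergence applies to both parts of the Dirichlet norm.
\<close>

lemma truncation_approx:
  assumes F: "F \<in> Dom_D \<nu> P"
  obtains H where "\<And>n::nat. H n \<in> bounded_Dom_D \<nu> P"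
    and "(\<lambda>n. dirichlet_norm \<nu> P (\<lambda>\<eta>. H n \<eta> - F \<eta>)) \<longlonglongrightarrow> 0"
proof -
  note [measurable] = Dom_D_measurable[OF F]
  define clamp where "clamp n a = max (- real n) (min (real n) a)" for n and a :: real
  define H where "H n \<eta> = clamp n (F \<eta>)" for n \<eta>
  have [measurable]: "H n \<in> borel_measurable P" for n
    unfolding H_def clamp_def by measurable
  have clamp_le: "\<bar>clamp n a\<bar> \<le> \<bar>a\<bar>" and clamp_diff: "\<bar>clamp n a - clamp n b\<bar> \<le> \<bar>a - b\<bar>"
    and clamp_bound: "\<bar>clamp n a\<bar> \<le> real n" for n a b
    by (auto simp: clamp_def)
  have clamp_lim: "(\<lambda>n. clamp n a) \<longlonglongrightarrow> a" for a
  proof (rule tendsto_eventually)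
    show "eventually (\<lambda>n. clamp n a = a) sequentially"
      using eventually_ge_at_top[of "nat \<lceil>\<bar>a\<bar>\<rceil>"]
    proof eventually_elim
      case (elim n)
      then have "\<bar>a\<bar> \<le> real n"
        by linarith
      then show ?case
        by (auto simp: clamp_def)
    qed
  qed
  have H_le: "\<bar>H n \<eta>\<bar> \<le> \<bar>F \<eta>\<bar>" and grad_H_le: "\<bar>grad (H n) x\<bar> \<le> \<bar>grad F x\<bar>" for n \<eta> x
    by (auto simp: H_def add_diff_def clamp_le clamp_diff)
  have diff_sq: "(a - b)\<^sup>2 \<le> 4 * b\<^sup>2" if "\<bar>a\<bar> \<le> \<bar>b\<bar>" for a b :: real
  proof -
    have "\<bar>a - b\<bar> \<le> \<bar>2 * b\<bar>"
      using that by linarith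
    then show ?thesis
      unfolding abs_le_square_iff by (simp add: power_mult_distrib)
  qed
  have H: "H n \<in> bounded_Dom_D \<nu> P" for n
  proof -
    have "integrable P (\<lambda>\<eta>. (H n \<eta>)\<^sup>2)"
      by (rule Bochner_Integration.integrable_bound[OF Dom_D_square[OF F]])
        (auto simp: abs_le_square_iff[symmetric] H_le)
    moreover have "integrable (P \<Otimes>\<^sub>M \<nu>) (\<lambda>x. (grad (H n) x)\<^sup>2)"
      by (rule Bochner_Integration.integrable_bound[OF Dom_D_grad[OF F]])
        (auto simp: abs_le_square_iff[symmetric] grad_H_le)
    moreover have "AE \<eta> in P. \<bar>H n \<eta>\<bar> \<le> real n"
      by (auto simp: H_def clamp_bound)
    ultimately show ?thesis
      by (auto simp: bounded_Dom_D_def Dom_D_iff)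
  qed
  have "(\<lambda>n. \<integral>\<eta>. (H n \<eta> - F \<eta>)\<^sup>2 \<partial>P) \<longlonglongrightarrow> (\<integral>\<eta>. 0 \<partial>P)"
  proof (rule integral_dominated_convergence)
    show "integrable P (\<lambda>\<eta>. 4 * (F \<eta>)\<^sup>2)"
      using Dom_D_square[OF F] by simp
    show "AE \<eta> in P. (\<lambda>n. (H n \<eta> - F \<eta>)\<^sup>2) \<longlonglongrightarrow> 0"
    proof (rule AE_I2)
      fix \<eta>
      have "(\<lambda>n. (H n \<eta> - F \<eta>)\<^sup>2) \<longlonglongrightarrow> (F \<eta> - F \<eta>)\<^sup>2"
        unfolding H_def by (rule tendsto_power[OF tendsto_diff[OF clamp_lim tendsto_const]])
      then show "(\<lambda>n. (H n \<eta> - F \<eta>)\<^sup>2) \<longlonglongrightarrow> 0"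
        by simp
    qed
    show "AE \<eta> in P. norm ((H n \<eta> - F \<eta>)\<^sup>2) \<le> 4 * (F \<eta>)\<^sup>2" for n
      using diff_sq[OF H_le] by auto
  qed measurable
  moreover have "(\<lambda>n. \<integral>x. (grad (H n) x - grad F x)\<^sup>2 \<partial>(P \<Otimes>\<^sub>M \<nu>)) \<longlonglongrightarrow> (\<integral>x. 0 \<partial>(P \<Otimes>\<^sub>M \<nu>))"
  proof (rule integral_dominated_convergence)
    show "integrable (P \<Otimes>\<^sub>M \<nu>) (\<lambda>x. 4 * (grad F x)\<^sup>2)"
      using Dom_D_grad[OF F] by simp
    show "AE x in P \<Otimes>\<^sub>M \<nu>. (\<lambda>n. (grad (H n) x - grad F x)\<^sup>2) \<longlonglongrightarrow> 0"
    proof (rule AE_I2)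
      fix x
      have "(\<lambda>n. (grad (H n) x - grad F x)\<^sup>2) \<longlonglongrightarrow> (grad F x - grad F x)\<^sup>2"
        unfolding H_def add_diff_def
        by (rule tendsto_power[OF tendsto_diff[OF tendsto_diff[OF clamp_lim clamp_lim] tendsto_const]])
      then show "(\<lambda>n. (grad (H n) x - grad F x)\<^sup>2) \<longlonglongrightarrow> 0"
        by simp
    qed
    show "AE x in P \<Otimes>\<^sub>M \<nu>. norm ((grad (H n) x - grad F x)\<^sup>2) \<le> 4 * (grad F x)\<^sup>2" for n
      using diff_sq[OF grad_H_le] by auto
  qed measurable
  moreover have "(\<integral>x. (grad (H n) x - grad F x)\<^sup>2 \<partial>(P \<Otimes>\<^sub>M \<nu>)) =
      dirichlet_form \<nu> P (\<lambda>\<eta>. H n \<eta> - F \<eta>) (\<lambda>\<eta>. H n \<eta> - F \<eta>)" for n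
    unfolding dirichlet_form_eq
    by (intro Bochner_Integration.integral_cong refl) (simp add: add_diff_def power2_eq_square algebra_simps)
  ultimately have "(\<lambda>n. dirichlet_norm \<nu> P (\<lambda>\<eta>. H n \<eta> - F \<eta>)) \<longlonglongrightarrow> sqrt (0 + 0)"
    unfolding dirichlet_norm_def by (intro tendsto_real_sqrt tendsto_add) auto
  with H show thesis
    by (intro that[of H]) auto
qed

text \<open>
  The truncations show that the filter defining the extension by continuity is not trivial, so that
  its limit is unique; continuity of the weighted energy identifies the limit.
\<close>

lemma carre_form_eq:
  assumes F: "F \<in> Dom_D \<nu> P" and \<Phi>: "\<Phi> \<in> bounded_Dom_D \<nu> P"
  shows "carre_form \<nu> P F \<Phi> = weighted_energy F \<Phi>"
proof -
  define N where "N H = dirichlet_norm \<nu> P (\<lambda>\<eta>. H \<eta> - F \<eta>)" for H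
  let ?filter = "N going_to nhds 0 within bounded_Dom_D \<nu> P"
  have \<Phi>' [measurable]: "\<Phi> \<in> borel_measurable P"
    using \<Phi> by (simp add: bounded_Dom_D_def Dom_D_measurable)
  obtain c where c: "0 \<le> c" "AE x in P \<Otimes>\<^sub>M \<nu>. \<bar>\<Phi> (fst x)\<bar> \<le> c \<and> \<bar>\<Phi> (shift x)\<bar> \<le> c"
    using \<Phi> by (rule bounded_Dom_D_bound)
  define e where "e = dirichlet_form \<nu> P F F"
  have "0 \<le> e"
    by (simp add: e_def dirichlet_form_eq)
  have "?filter \<noteq> bot"
  proof
    assume "?filter = bot"
    then have "eventually (\<lambda>_. False) ?filter"
      by simp
    then obtain Q where Q: "eventually Q (nhds 0)" "\<And>H. Q (N H) \<Longrightarrow> H \<notin> bounded_Dom_D \<nu> P"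
      by (auto simp: going_to_within_def eventually_inf_principal eventually_filtercomap)
    obtain H where H: "\<And>n::nat. H n \<in> bounded_Dom_D \<nu> P" and lim: "(\<lambda>n. N (H n)) \<longlonglongrightarrow> 0"
      unfolding N_def using truncation_approx[OF F] by blast
    from lim Q(1) have "eventually (\<lambda>n. Q (N (H n))) sequentially"
      by (simp add: filterlim_iff)
    then obtain n where "Q (N (H n))"
      by (auto simp: eventually_sequentially)
    with Q(2) H show False
      by blast
  qed
  moreover have "((\<lambda>H. carre_form_bounded \<nu> P H \<Phi>) \<longlongrightarrow> weighted_energy F \<Phi>) ?filter"
  proof (rule tendstoI)
    fix \<epsilon> :: real assume "0 < \<epsilon>"
    define t where "t = \<epsilon> / 2 / (c * e + 1)"
    have pos: "0 < c * e + 1"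
      using c(1) \<open>0 \<le> e\<close> by (simp add: add_nonneg_pos)
    then have "0 < t"
      using \<open>0 < \<epsilon>\<close> by (simp add: t_def)
    have "c * e * t \<le> (c * e + 1) * t"
      using \<open>0 < t\<close> by (simp add: algebra_simps)
    also have "\<dots> = \<epsilon> / 2"
      unfolding t_def using pos
      by (subst times_divide_eq_right, subst nonzero_mult_div_cancel_left) auto
    finally have small: "c * (t * e) \<le> \<epsilon> / 2"
      by (simp add: mult_ac)
    have "((\<lambda>r. c * ((1 + 1 / t) * r\<^sup>2 + t * e)) \<longlongrightarrow> c * ((1 + 1 / t) * 0\<^sup>2 + t * e)) (nhds 0)"
      by (intro tendsto_intros filterlim_ident)
    then have "eventually (\<lambda>r. c * ((1 + 1 / t) * r\<^sup>2 + t * e) < \<epsilon>) (nhds 0)"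
      by (rule order_tendstoD(2)) (use small \<open>0 < \<epsilon>\<close> in simp)
    then have "eventually (\<lambda>H. c * ((1 + 1 / t) * (N H)\<^sup>2 + t * e) < \<epsilon>) (filtercomap N (nhds 0))"
      by (rule eventually_filtercomapI)
    then show "eventually (\<lambda>H. dist (carre_form_bounded \<nu> P H \<Phi>) (weighted_energy F \<Phi>) < \<epsilon>) ?filter"
      unfolding going_to_within_def eventually_inf_principal
    proof eventually_elim
      case (elim H)
      show ?case
      proof
        assume H: "H \<in> bounded_Dom_D \<nu> P"
        then have "H \<in> Dom_D \<nu> P"
          by (simp add: bounded_Dom_D_def)
        from weighted_energy_diff_bound[OF this F \<Phi>' c(1) \<open>0 < t\<close> c(2)] elim
        show "dist (carre_form_bounded \<nu> P H \<Phi>) (weighted_energy F \<Phi>) < \<epsilon>"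
          by (simp add: carre_form_bounded_eq[OF H \<Phi>] dist_real_def N_def e_def)
      qed
    qed
  qed
  ultimately show ?thesis
    unfolding carre_form_def N_def by (rule tendsto_Lim)
qed

text \<open>
  For nonnegative weights the Mecke identity for \<open>\<gamma>\<close> passes from extended nonnegative to real
  integrals; \<open>\<gamma>\<close> is finite almost everywhere, so nothing is lost in taking its real value.
\<close>

lemma weighted_energy_eq_integral_nonneg:
  assumes F: "F \<in> Dom_D \<nu> P"
    and \<gamma> [measurable]: "\<gamma> \<in> borel_measurable P" and fin: "AE \<eta> in P. \<gamma> \<eta> \<noteq> \<infinity>"
    and \<gamma>_eq: "\<And>\<phi>. \<phi> \<in> borel_measurable P \<Longrightarrow> (\<integral>\<^sup>+\<eta>. \<gamma> \<eta> * \<phi> \<eta> \<partial>P) =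
      (\<integral>\<^sup>+x. ennreal ((grad F x)\<^sup>2) * (\<phi> (fst x) + \<phi> (shift x)) \<partial>(P \<Otimes>\<^sub>M \<nu>)) / 2"
    and \<Psi> [measurable]: "\<Psi> \<in> borel_measurable P"
    and bounds: "AE \<eta> in P. 0 \<le> \<Psi> \<eta> \<and> \<Psi> \<eta> \<le> c"
  shows "weighted_energy F \<Psi> = (\<integral>\<eta>. enn2real (\<gamma> \<eta>) * \<Psi> \<eta> \<partial>P)"
proof -
  note [measurable] = Dom_D_measurable[OF F]
  have bounds2: "AE x in P \<Otimes>\<^sub>M \<nu>. 0 \<le> \<Psi> (fst x) \<and> 0 \<le> \<Psi> (shift x)"
    and bounds3: "AE x in P \<Otimes>\<^sub>M \<nu>. \<bar>\<Psi> (fst x)\<bar> \<le> c \<and> \<bar>\<Psi> (shift x)\<bar> \<le> c"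
    using AE_fst[OF bounds] AE_add_point[OF bounds] by auto
  let ?f = "\<lambda>x. (grad F x)\<^sup>2 * (\<Psi> (fst x) + \<Psi> (shift x))"
  have f_nonneg: "AE x in P \<Otimes>\<^sub>M \<nu>. 0 \<le> ?f x"
    using bounds2 by auto
  have "(\<integral>\<^sup>+\<eta>. ennreal (enn2real (\<gamma> \<eta>) * \<Psi> \<eta>) \<partial>P) = (\<integral>\<^sup>+\<eta>. \<gamma> \<eta> * ennreal (\<Psi> \<eta>) \<partial>P)"
    using bounds fin
    by (intro nn_integral_cong_AE) (auto simp: ennreal_mult' less_top)
  also have "\<dots> = (\<integral>\<^sup>+x. ennreal ((grad F x)\<^sup>2) *
      (ennreal (\<Psi> (fst x)) + ennreal (\<Psi> (shift x))) \<partial>(P \<Otimes>\<^sub>M \<nu>)) / 2"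
    using \<gamma>_eq[of "\<lambda>\<eta>. ennreal (\<Psi> \<eta>)"] by simp
  also have "(\<integral>\<^sup>+x. ennreal ((grad F x)\<^sup>2) *
      (ennreal (\<Psi> (fst x)) + ennreal (\<Psi> (shift x))) \<partial>(P \<Otimes>\<^sub>M \<nu>)) =
      (\<integral>\<^sup>+x. ennreal (?f x) \<partial>(P \<Otimes>\<^sub>M \<nu>))"
    using bounds2 by (intro nn_integral_cong_AE) (auto simp: ennreal_mult)
  also have "\<dots> = ennreal (\<integral>x. ?f x \<partial>(P \<Otimes>\<^sub>M \<nu>))"
    using integrable_weighted_energy[OF F \<Psi> bounds3] f_nonneg by (rule nn_integral_eq_integral)
  also have "\<dots> / 2 = ennreal (weighted_energy F \<Psi>)"
    using integral_nonneg_AE[OF f_nonneg] by (simp add: weighted_energy_def ennreal_divide_numeral)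
  finally have "(\<integral>\<^sup>+\<eta>. ennreal (enn2real (\<gamma> \<eta>) * \<Psi> \<eta>) \<partial>P) = ennreal (weighted_energy F \<Psi>)" .
  moreover have "(\<integral>\<eta>. enn2real (\<gamma> \<eta>) * \<Psi> \<eta> \<partial>P) =
      enn2real (\<integral>\<^sup>+\<eta>. ennreal (enn2real (\<gamma> \<eta>) * \<Psi> \<eta>) \<partial>P)"
    using bounds by (intro integral_eq_nn_integral) auto
  moreover have "0 \<le> weighted_energy F \<Psi>"
    using integral_nonneg_AE[OF f_nonneg] by (simp add: weighted_energy_def)
  ultimately show ?thesis
    by simp
qed

text \<open>
  The identity for nonnegative weights extends to a bounded weight \<open>\<Phi>\<close> by adding a constant.
\<close>

lemma ex_carre_du_champ:
  assumes F: "F \<in> Dom_D \<nu> P" and w: "drop_diff_version \<nu> P F w"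
  obtains G where "is_carre_du_champ \<nu> P F G"
    and "AE \<eta> in P. ennreal (G \<eta>) = gamma_integral F w \<eta>"
proof -
  note [measurable] = Dom_D_measurable[OF F]
  obtain \<gamma> where \<gamma> [measurable]: "\<gamma> \<in> borel_measurable P"
    and \<gamma>_AE: "AE \<eta> in P. gamma_integral F w \<eta> = \<gamma> \<eta>"
    and \<gamma>_eq: "\<And>\<phi>. \<phi> \<in> borel_measurable P \<Longrightarrow> (\<integral>\<^sup>+\<eta>. \<gamma> \<eta> * \<phi> \<eta> \<partial>P) =
      (\<integral>\<^sup>+x. ennreal ((grad F x)\<^sup>2) * (\<phi> (fst x) + \<phi> (shift x)) \<partial>(P \<Otimes>\<^sub>M \<nu>)) / 2"
    using ex_measurable_gamma_integral[OF Dom_D_measurable[OF F] w] by blast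
  have "(\<integral>\<^sup>+x. ennreal ((grad F x)\<^sup>2) * (1 + 1) \<partial>(P \<Otimes>\<^sub>M \<nu>)) < \<infinity>"
    using Dom_D_grad[OF F]
    by (simp add: integrable_iff_bounded nn_integral_multc ennreal_mult_less_top)
  then have total: "(\<integral>\<^sup>+\<eta>. \<gamma> \<eta> \<partial>P) < \<infinity>"
    using \<gamma>_eq[of "\<lambda>_. 1"] by (simp add: ennreal_divide_eq_top_iff flip: less_top)
  then have fin: "AE \<eta> in P. \<gamma> \<eta> \<noteq> \<infinity>"
    by (intro nn_integral_noteq_infinite) auto
  define G where "G \<eta> = enn2real (\<gamma> \<eta>)" for \<eta>
  have [measurable]: "G \<in> borel_measurable P"
    unfolding G_def by measurable
  have G_eq: "AE \<eta> in P. ennreal (G \<eta>) = \<gamma> \<eta>"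
    using fin by (auto simp: G_def less_top)
  have int_G: "integrable P G"
  proof (rule integrableI_bounded)
    have "(\<integral>\<^sup>+\<eta>. ennreal (norm (G \<eta>)) \<partial>P) = (\<integral>\<^sup>+\<eta>. \<gamma> \<eta> \<partial>P)"
      using G_eq by (intro nn_integral_cong_AE) (auto simp: G_def)
    with total show "(\<integral>\<^sup>+\<eta>. ennreal (norm (G \<eta>)) \<partial>P) < \<infinity>"
      by simp
  qed measurable
  have repr: "weighted_energy F \<Phi> = (\<integral>\<eta>. G \<eta> * \<Phi> \<eta> \<partial>P)" if \<Phi>: "\<Phi> \<in> bounded_Dom_D \<nu> P" for \<Phi>
  proof -
    have \<Phi>_meas [measurable]: "\<Phi> \<in> borel_measurable P"
      using \<Phi> by (simp add: bounded_Dom_D_def Dom_D_measurable)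
    obtain c where "0 \<le> c" and c: "AE \<eta> in P. \<bar>\<Phi> \<eta>\<bar> \<le> c"
      and c2: "AE x in P \<Otimes>\<^sub>M \<nu>. \<bar>\<Phi> (fst x)\<bar> \<le> c \<and> \<bar>\<Phi> (shift x)\<bar> \<le> c"
      using \<Phi> by (rule bounded_Dom_D_bound)
    note nonneg_case = weighted_energy_eq_integral_nonneg[OF F \<gamma> fin \<gamma>_eq, folded G_def]
    have "AE \<eta> in P. 0 \<le> \<Phi> \<eta> + c \<and> \<Phi> \<eta> + c \<le> 2 * c"
      using c by (rule AE_mp) (auto intro!: AE_I2)
    then have shifted: "weighted_energy F (\<lambda>\<eta>. \<Phi> \<eta> + c) = (\<integral>\<eta>. G \<eta> * (\<Phi> \<eta> + c) \<partial>P)"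
      by (intro nonneg_case[where c = "2 * c"]) auto
    have const: "weighted_energy F (\<lambda>_. c) = (\<integral>\<eta>. G \<eta> * c \<partial>P)"
      using \<open>0 \<le> c\<close> by (intro nonneg_case[where c = c]) auto
    have "integrable P (\<lambda>\<eta>. G \<eta> * \<Phi> \<eta>)"
    proof (rule Bochner_Integration.integrable_bound)
      show "integrable P (\<lambda>\<eta>. G \<eta> * c)"
        using int_G by simp
      show "AE \<eta> in P. norm (G \<eta> * \<Phi> \<eta>) \<le> norm (G \<eta> * c)"
        using c \<open>0 \<le> c\<close> by (auto simp: abs_mult intro!: mult_left_mono)
    qed measurable
    then have "(\<integral>\<eta>. G \<eta> * \<Phi> \<eta> \<partial>P) = (\<integral>\<eta>. G \<eta> * (\<Phi> \<eta> + c) \<partial>P) - (\<integral>\<eta>. G \<eta> * c \<partial>P)"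
      using int_G by (simp add: distrib_left)
    moreover have "integrable (P \<Otimes>\<^sub>M \<nu>) (\<lambda>x. (grad F x)\<^sup>2 * (c + c))"
      using Dom_D_grad[OF F] by simp
    then have "weighted_energy F (\<lambda>\<eta>. \<Phi> \<eta> + c) = weighted_energy F \<Phi> + weighted_energy F (\<lambda>_. c)"
      using integrable_weighted_energy[OF F \<Phi>_meas c2]
      unfolding weighted_energy_def add_divide_distrib[symmetric]
      by (subst Bochner_Integration.integral_add[symmetric])
        (auto intro!: Bochner_Integration.integral_cong simp: algebra_simps)
    ultimately show ?thesis
      using shifted const by simp
  qed
  show thesis
  proof
    show "is_carre_du_champ \<nu> P F G"
      using int_G repr carre_form_eq[OF F] by (auto simp: is_carre_du_champ_def G_def)
    show "AE \<eta> in P. ennreal (G \<eta>) = gamma_integral F w \<eta>"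
      using G_eq \<gamma>_AE by auto
  qed
qed

section \<open>Uniqueness of the density\<close>

definition Dom_D_sets :: "'z measure set set" where
  "Dom_D_sets = {A \<in> sets P. (indicator A :: _ \<Rightarrow> real) \<in> Dom_D \<nu> P}"

lemma Dom_D_sets_iff:
  "A \<in> Dom_D_sets \<longleftrightarrow> A \<in> sets P \<and>
    integrable (P \<Otimes>\<^sub>M \<nu>) (\<lambda>x. (grad (indicator A) x)\<^sup>2)"
proof -
  have "integrable P (\<lambda>\<eta>. (indicator A \<eta> :: real)\<^sup>2)" if [measurable]: "A \<in> sets P"
    by (rule law.integrable_const_bound[where B = 1]) (auto simp: indicator_def)
  then show ?thesis
    by (auto simp: Dom_D_sets_def Dom_D_iff)
qed

lemma indicator_bounded_Dom_D:
  "A \<in> Dom_D_sets \<Longrightarrow> (indicator A :: _ \<Rightarrow> real) \<in> bounded_Dom_D \<nu> P"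
  by (auto simp: Dom_D_sets_def bounded_Dom_D_def intro!: exI[of _ 1] split: split_indicator)

text \<open>
  If adding a point changes membership in \<open>A \<inter> B\<close>, it changes membership in \<open>A\<close> or in \<open>B\<close>.
\<close>

lemma Int_stable_Dom_D_sets: "Int_stable Dom_D_sets"
proof (rule Int_stableI)
  fix A B assume "A \<in> Dom_D_sets" "B \<in> Dom_D_sets"
  then have [measurable]: "A \<in> sets P" "B \<in> sets P"
    and int: "integrable (P \<Otimes>\<^sub>M \<nu>) (\<lambda>x. (grad (indicator A) x)\<^sup>2)"
      "integrable (P \<Otimes>\<^sub>M \<nu>) (\<lambda>x. (grad (indicator B) x)\<^sup>2)"
    by (auto simp: Dom_D_sets_iff)
  have "integrable (P \<Otimes>\<^sub>M \<nu>) (\<lambda>x. (grad (indicator (A \<inter> B)) x)\<^sup>2)"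
  proof (rule Bochner_Integration.integrable_bound)
    show "integrable (P \<Otimes>\<^sub>M \<nu>) (\<lambda>x. (grad (indicator A) x)\<^sup>2 + (grad (indicator B) x)\<^sup>2)"
      using int by simp
    show "AE x in P \<Otimes>\<^sub>M \<nu>. norm ((grad (indicator (A \<inter> B)) x)\<^sup>2) \<le>
        norm ((grad (indicator A) x)\<^sup>2 + (grad (indicator B) x)\<^sup>2)"
      by (intro AE_I2) (auto simp: add_diff_def indicator_def)
  qed measurable
  then show "A \<inter> B \<in> Dom_D_sets"
    by (simp add: Dom_D_sets_iff)
qed

text \<open>
  Adding a point outside \<open>B\<close> does not affect the event, so the squared add operator is at most the
  indicator of \<open>z \<in> B\<close>.
\<close>

lemma count_event_Dom_D_sets:
  assumes B [measurable]: "B \<in> sets \<nu>" and fin: "emeasure \<nu> B \<noteq> \<infinity>" and S [measurable]: "S \<in> sets borel"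
  shows "{\<eta> \<in> space P. emeasure \<eta> B \<in> S} \<in> Dom_D_sets"
proof -
  let ?A = "{\<eta> \<in> space P. emeasure \<eta> B \<in> S}"
  have [measurable]: "?A \<in> sets P"
    by measurable
  have "emeasure (P \<Otimes>\<^sub>M \<nu>) (space P \<times> B) < \<infinity>"
    using fin by (simp add: intensity.emeasure_pair_measure_Times law.emeasure_space_1 less_top)
  then have int: "integrable (P \<Otimes>\<^sub>M \<nu>) (indicator (space P \<times> B) :: _ \<Rightarrow> real)"
    by (intro integrable_real_indicator) auto
  have "integrable (P \<Otimes>\<^sub>M \<nu>) (\<lambda>x. (grad (indicator ?A) x)\<^sup>2)"
  proof (rule Bochner_Integration.integrable_bound[OF int])
    show "AE x in P \<Otimes>\<^sub>M \<nu>. norm ((grad (indicator ?A) x)\<^sup>2) \<le>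
        norm (indicator (space P \<times> B) x :: real)"
    proof (rule AE_I2)
      fix x assume "x \<in> space (P \<Otimes>\<^sub>M \<nu>)"
      then have x: "fst x \<in> space P" "shift x \<in> space P" "B \<in> sets (fst x)"
        by (auto simp: space_pair_measure add_point_in_space sets_config)
      show "norm ((grad (indicator ?A) x)\<^sup>2) \<le> norm (indicator (space P \<times> B) x :: real)"
      proof (cases "snd x \<in> B")
        case True
        with x show ?thesis
          by (cases x) (auto simp: add_diff_def indicator_def)
      next
        case False
        with x have "emeasure (shift x) B = emeasure (fst x) B"
          by (simp add: emeasure_add_point)
        with x show ?thesis
          by (simp add: add_diff_def indicator_def)
      qed
    qed
  qed measurable
  then show ?thesis
    by (simp add: Dom_D_sets_iff)
qed

text \<open>
  The count of an arbitrary set is the sum of its counts in the windows, which have finite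
  intensity.
\<close>

lemma sets_eq_sigma_Dom_D_sets: "sets P = sigma_sets (space P) Dom_D_sets"
proof
  have sub: "Dom_D_sets \<subseteq> sets P"
    by (auto simp: Dom_D_sets_def)
  then show "sigma_sets (space P) Dom_D_sets \<subseteq> sets P"
    by (rule sets.sigma_sets_subset)
  have Pow: "Dom_D_sets \<subseteq> Pow (space P)"
    using sub sets.space_closed by blast
  let ?N = "sigma (space P) Dom_D_sets"
  have window_meas: "(\<lambda>\<eta>. emeasure \<eta> B) \<in> borel_measurable ?N"
    if "B \<in> sets \<nu>" "emeasure \<nu> B \<noteq> \<infinity>" for B
  proof (rule measurableI)
    fix S :: "ennreal set" assume "S \<in> sets borel"
    with that have "{\<eta> \<in> space P. emeasure \<eta> B \<in> S} \<in> Dom_D_sets"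
      by (rule count_event_Dom_D_sets)
    then have "{\<eta> \<in> space P. emeasure \<eta> B \<in> S} \<in> sets ?N"
      using Pow by (auto simp: sets_measure_of)
    also have "{\<eta> \<in> space P. emeasure \<eta> B \<in> S} = (\<lambda>\<eta>. emeasure \<eta> B) -` S \<inter> space ?N"
      using Pow by (auto simp: space_measure_of)
    finally show "(\<lambda>\<eta>. emeasure \<eta> B) -` S \<inter> space ?N \<in> sets ?N" .
  qed simp
  have "(\<lambda>\<eta>. \<eta>) \<in> ?N \<rightarrow>\<^sub>M point_measure_space \<nu>"
  proof (rule measurable_point_measure_spaceI)
    show "(\<lambda>\<eta>. \<eta>) \<in> space ?N \<rightarrow> point_measures \<nu>"
      using Pow by (simp add: space_measure_of space_law)
    fix B assume B: "B \<in> sets \<nu>"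
    have "(\<lambda>\<eta>. \<Sum>n. emeasure \<eta> (window n \<inter> B)) \<in> borel_measurable ?N"
    proof (intro borel_measurable_suminf_order window_meas)
      fix n
      show "window n \<inter> B \<in> sets \<nu>"
        using B by simp
      show "emeasure \<nu> (window n \<inter> B) \<noteq> \<infinity>"
        using B window_finite[of n] emeasure_mono[of "window n \<inter> B" "window n" \<nu>]
        by (auto simp: top_unique)
    qed
    also have "?this \<longleftrightarrow> (\<lambda>\<eta>. emeasure \<eta> B) \<in> borel_measurable ?N"
    proof (rule measurable_cong)
      fix \<eta> assume "\<eta> \<in> space ?N"
      then have \<eta>: "sets \<eta> = sets \<nu>"
        using Pow by (simp add: space_measure_of sets_config)
      have "(\<Sum>n. emeasure \<eta> (window n \<inter> B)) = emeasure \<eta> (\<Union>n. window n \<inter> B)"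
        using B disjoint_window \<eta>
        by (intro suminf_emeasure) (auto simp: disjoint_family_on_def)
      also have "(\<Union>n. window n \<inter> B) = B"
        using UN_window sets.sets_into_space[OF B] by blast
      finally show "(\<Sum>n. emeasure \<eta> (window n \<inter> B)) = emeasure \<eta> B" .
    qed
    finally show "(\<lambda>\<eta>. emeasure \<eta> B) \<in> borel_measurable ?N" .
  qed
  then have id: "(\<lambda>\<eta>. \<eta>) \<in> ?N \<rightarrow>\<^sub>M P"
    using measurable_cong_sets[OF refl sets_law] by blast
  show "sets P \<subseteq> sigma_sets (space P) Dom_D_sets"
  proof
    fix A assume A: "A \<in> sets P"
    have "(\<lambda>\<eta>. \<eta>) -` A \<inter> space ?N = A"
      using sets.sets_into_space[OF A] Pow by (auto simp: space_measure_of)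
    with measurable_sets[OF id A] have "A \<in> sets ?N"
      by simp
    then show "A \<in> sigma_sets (space P) Dom_D_sets"
      using Pow by (simp add: sets_measure_of)
  qed
qed

text \<open>
  The two densities define finite measures that agree on the generating system \<open>Dom_D_sets\<close>.
\<close>

lemma AE_eq_if_bounded_Dom_D_integrals_eq:
  assumes G1: "integrable P G1" "AE \<eta> in P. 0 \<le> G1 \<eta>"
    and G2: "integrable P G2" "AE \<eta> in P. 0 \<le> G2 \<eta>"
    and eq: "\<And>\<Phi>. \<Phi> \<in> bounded_Dom_D \<nu> P \<Longrightarrow> (\<integral>\<eta>. G1 \<eta> * \<Phi> \<eta> \<partial>P) = (\<integral>\<eta>. G2 \<eta> * \<Phi> \<eta> \<partial>P)"
  shows "AE \<eta> in P. G1 \<eta> = G2 \<eta>"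
proof -
  have [measurable]: "G1 \<in> borel_measurable P" "G2 \<in> borel_measurable P"
    using G1 G2 by auto
  have density: "emeasure (density P (\<lambda>\<eta>. ennreal (G \<eta>))) A = ennreal (\<integral>\<eta>. G \<eta> * indicator A \<eta> \<partial>P)"
    if G: "integrable P G" "AE \<eta> in P. 0 \<le> G \<eta>" and A [measurable]: "A \<in> sets P" for G A
  proof -
    have [measurable]: "G \<in> borel_measurable P"
      using G by auto
    have "emeasure (density P (\<lambda>\<eta>. ennreal (G \<eta>))) A = (\<integral>\<^sup>+\<eta>. ennreal (G \<eta> * indicator A \<eta>) \<partial>P)"
      by (simp add: emeasure_density) (auto intro!: nn_integral_cong split: split_indicator)
    also have "\<dots> = ennreal (\<integral>\<eta>. G \<eta> * indicator A \<eta> \<partial>P)"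
      using G by (intro nn_integral_eq_integral integrable_real_mult_indicator) auto
    finally show ?thesis .
  qed
  have space: "space P \<in> Dom_D_sets"
    using count_event_Dom_D_sets[of "{}" UNIV] by simp
  have "density P (\<lambda>\<eta>. ennreal (G1 \<eta>)) = density P (\<lambda>\<eta>. ennreal (G2 \<eta>))"
  proof (rule measure_eqI_generator_eq[where A = "\<lambda>_. space P"])
    show "Int_stable Dom_D_sets"
      by (rule Int_stable_Dom_D_sets)
    show "Dom_D_sets \<subseteq> Pow (space P)"
      using sets.space_closed by (auto simp: Dom_D_sets_def)
    show "emeasure (density P (\<lambda>\<eta>. ennreal (G1 \<eta>))) A = emeasure (density P (\<lambda>\<eta>. ennreal (G2 \<eta>))) A"
      if "A \<in> Dom_D_sets" for A
      using that eq[OF indicator_bounded_Dom_D[OF that]]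
      by (simp add: density[OF G1] density[OF G2] Dom_D_sets_def)
    show "emeasure (density P (\<lambda>\<eta>. ennreal (G1 \<eta>))) (space P) \<noteq> \<infinity>" for i :: nat
      by (simp add: density[OF G1])
  qed (use space sets_eq_sigma_Dom_D_sets in auto)
  then have "AE \<eta> in P. ennreal (G1 \<eta>) = ennreal (G2 \<eta>)"
    by (intro law.density_unique) auto
  then show ?thesis
    using G1(2) G2(2) by (auto simp: ennreal_inj)
qed

end

section \<open>The carre du champ of a Poisson functional\<close>

theorem proposition2:
  fixes \<nu> :: "'z measure" and P :: "'z measure measure"
  assumes "sigma_finite_measure \<nu>"
    and "poisson_law \<nu> P"
  shows "Dom_Gamma \<nu> P = Dom_D \<nu> P \<and>
    (\<forall>F\<in>Dom_D \<nu> P.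
       (\<exists>w. drop_diff_version \<nu> P F w) \<and>
       (\<forall>G w. is_carre_du_champ \<nu> P F G \<longrightarrow> drop_diff_version \<nu> P F w \<longrightarrow>
          (AE \<eta> in P. ennreal (G \<eta>) =
             (\<integral>\<^sup>+z. ennreal ((add_diff F z \<eta>)\<^sup>2) \<partial>\<nu>) / 2 +
             (\<integral>\<^sup>+z. ennreal ((w (\<eta>, z))\<^sup>2) \<partial>\<eta>) / 2)))"
proof -
  interpret poisson_process \<nu> P
    using assms by (rule poisson_process.intro)
  have version: "\<exists>w. drop_diff_version \<nu> P F w" if "F \<in> Dom_D \<nu> P" for F
    using that by (intro ex_drop_diff_version Dom_D_measurable)
  have "F \<in> Dom_Gamma \<nu> P" if F: "F \<in> Dom_D \<nu> P" for F
    using version[OF F] ex_carre_du_champ[OF F] F by (auto simp: Dom_Gamma_def)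
  then have "Dom_Gamma \<nu> P = Dom_D \<nu> P"
    by (auto simp: Dom_Gamma_def)
  moreover have "AE \<eta> in P. ennreal (G \<eta>) = gamma_integral F w \<eta>"
    if F: "F \<in> Dom_D \<nu> P" and G: "is_carre_du_champ \<nu> P F G" and w: "drop_diff_version \<nu> P F w"
    for F G w
  proof -
    obtain G' where G': "is_carre_du_champ \<nu> P F G'"
      and G'_eq: "AE \<eta> in P. ennreal (G' \<eta>) = gamma_integral F w \<eta>"
      using F w by (rule ex_carre_du_champ)
    have "AE \<eta> in P. G \<eta> = G' \<eta>"
      using G G' by (intro AE_eq_if_bounded_Dom_D_integrals_eq) (auto simp: is_carre_du_champ_def)
    with G'_eq show ?thesis
      by auto
  qed
  ultimately show ?thesis
    using version unfolding gamma_integral_def by blast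
qed

end
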